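(* For every integer $n\ge 0$, $$F_1(n,o)=\frac{11}{14}-\frac{5}{42}\Bigl(\frac1{15}\Bigr)^n,\qquad G_1(n,o)=\frac{11}{14}+\frac{3}{14}\Bigl(\frac1{15}\Bigr)^n,$$ $$F_2(n,o)=\frac{3}{14}+\frac{5}{42}\Bigl(\frac1{15}\Bigr)^n,\qquad G_2(n,o)=\frac{3}{14}-\frac{3}{14}\Bigl(\frac1{15}\Bigr)^n .$$
   Context: The two-dimensional Sierpinski gasket graph $SG(n)$, $n\ge 0$, is drawn in the plane with three outmost vertices: leftmost $o$, rightmost $a_n$, topmost $b_n$. $SG(0)$ is a triangle (3 vertices, 3 edges). $SG(n+1)$ consists of three copies of $SG(n)$ (lower-left, lower-right, top), where the rightmost vertex of the lower-left copy is identified with the leftmost vertex of the lower-right copy, the topmost vertex of the lower-left copy with the leftmost vertex of the top copy, and the topmost vertex of the lower-right copy with the rightmost vertex of the top copy. Definitions: $f(n)$ is the number of spanning trees of $SG(n)$; $g(n)$ is the number of spanning subgraphs of $SG(n)$ consisting of exactly two trees (an isolated vertex counts as a tree) such that $b_n$ lies in one tree and $o,a_n$ both lie in the other. For a vertex $x$ and integer $i\ge0$, $f_i(n,x)$ and $g_i(n,x)$ are the numbers of those subgraphs counted by $f(n)$ and $g(n)$, respectively, in which exactly $i$ edges of the subgraph are incident to $x$. $F_i(n,x)=f_i(n,x)/f(n)$ and $G_i(n,x)=g_i(n,x)/g(n)$. *)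

theory Defs
  imports Complex_Main "HOL-Library.Product_Plus"
begin

section \<open>Finite simple graphs\<close>

text \<open>
  A graph is given by a vertex set and a set of two-element edges. (The notions of forest and tree
  in the AFP entry on digraphs refer to directed cycles, so that a symmetric pair of arcs already
  is a cycle; they do not describe undirected trees.)
\<close>

definition simple_graph :: "'v set \<Rightarrow> 'v set set \<Rightarrow> bool" where
  "simple_graph V E \<longleftrightarrow> finite V \<and> (\<forall>e\<in>E. e \<subseteq> V \<and> card e = 2)"

definition graph_connected :: "'v set \<Rightarrow> 'v set set \<Rightarrow> bool" where
  "graph_connected V E \<longleftrightarrow>
     V \<noteq> {} \<and> (\<forall>u\<in>V. \<forall>v\<in>V. (u, v) \<in> {(x, y). {x, y} \<in> E}\<^sup>*)"

definition graph_cycle :: "'v set set \<Rightarrow> 'v list \<Rightarrow> bool" where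
  "graph_cycle E vs \<longleftrightarrow> length vs \<ge> 3 \<and> distinct vs \<and>
     successively (\<lambda>u v. {u, v} \<in> E) vs \<and> {last vs, hd vs} \<in> E"

definition is_tree :: "'v set \<Rightarrow> 'v set set \<Rightarrow> bool" where
  "is_tree V E \<longleftrightarrow> simple_graph V E \<and> graph_connected V E \<and> (\<nexists>vs. graph_cycle E vs)"

definition incident_edges :: "'v set set \<Rightarrow> 'v \<Rightarrow> nat" where
  "incident_edges E x = card {e \<in> E. x \<in> e}"

text \<open>A spanning subgraph has all the vertices, so it is given by its set of edges.\<close>

definition spanning_trees :: "'v set \<Rightarrow> 'v set set \<Rightarrow> 'v set set set" where
  "spanning_trees V E = {T. T \<subseteq> E \<and> is_tree V T}"

text \<open>
  Spanning subgraphs consisting of exactly two trees, one containing all the vertices of \<open>P\<close>, the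
  other one all the vertices of \<open>Q\<close>.
\<close>

definition spanning_two_trees :: "'v set \<Rightarrow> 'v set set \<Rightarrow> 'v set \<Rightarrow> 'v set \<Rightarrow> 'v set set set" where
  "spanning_two_trees V E P Q = {T. T \<subseteq> E \<and>
     (\<exists>A B S R. A \<inter> B = {} \<and> A \<union> B = V \<and> S \<union> R = T \<and>
        is_tree A S \<and> is_tree B R \<and> P \<subseteq> A \<and> Q \<subseteq> B)}"


section \<open>The Sierpinski gasket graph\<close>

text \<open>
  Vertices are lattice points in oblique coordinates: \<open>(i, j)\<close> is drawn at the point
  \<open>i \<cdot> (1, 0) + j \<cdot> (1/2, \<surd>3/2)\<close> of the plane, so that the drawing of \<open>SG(n)\<close> is an equilateral
  triangle of side length \<open>2 ^ n\<close>.
\<close>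

type_synonym vertex = "nat \<times> nat"

definition sg_left :: vertex where
  "sg_left = (0, 0)"

definition sg_right :: "nat \<Rightarrow> vertex" where
  "sg_right n = (2 ^ n, 0)"

definition sg_top :: "nat \<Rightarrow> vertex" where
  "sg_top n = (0, 2 ^ n)"

text \<open>
  The two further copies of \<open>SG(n)\<close> are translates, so that identified vertices are
  equal points.
\<close>

primrec sg_verts :: "nat \<Rightarrow> vertex set" where
  "sg_verts 0 = {sg_left, sg_right 0, sg_top 0}"
| "sg_verts (Suc n) =
     sg_verts n \<union> (+) (sg_right n) ` sg_verts n \<union> (+) (sg_top n) ` sg_verts n"

primrec sg_edges :: "nat \<Rightarrow> vertex set set" where
  "sg_edges 0 = {{sg_left, sg_right 0}, {sg_left, sg_top 0}, {sg_right 0, sg_top 0}}"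
| "sg_edges (Suc n) =
     sg_edges n \<union> (`) ((+) (sg_right n)) ` sg_edges n \<union> (`) ((+) (sg_top n)) ` sg_edges n"

text \<open>The three copies share the three prescribed vertices and no others.\<close>

lemma sg_corners: "sg_left \<in> sg_verts n" "sg_right n \<in> sg_verts n" "sg_top n \<in> sg_verts n"
proof -
  have "sg_left \<in> sg_verts n \<and> sg_right n \<in> sg_verts n \<and> sg_top n \<in> sg_verts n"
  proof (induction n)
    case (Suc n)
    have "sg_right (Suc n) = sg_right n + sg_right n" "sg_top (Suc n) = sg_top n + sg_top n"
      by (auto simp: sg_right_def sg_top_def)
    with Suc show ?case by auto
  qed auto
  then show "sg_left \<in> sg_verts n" "sg_right n \<in> sg_verts n" "sg_top n \<in> sg_verts n" by auto
qed

lemma sg_verts_bound: "(i, j) \<in> sg_verts n \<Longrightarrow> i + j \<le> 2 ^ n"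
proof (induction n arbitrary: i j)
  case 0
  then show ?case by (auto simp: sg_left_def sg_right_def sg_top_def)
next
  case (Suc n)
  then show ?case by (fastforce simp: sg_right_def sg_top_def)
qed

lemma sg_left_Int_right: "sg_verts n \<inter> (+) (sg_right n) ` sg_verts n = {sg_right n}"
  and sg_left_Int_top: "sg_verts n \<inter> (+) (sg_top n) ` sg_verts n = {sg_top n}"
  and sg_right_Int_top:
    "(+) (sg_right n) ` sg_verts n \<inter> (+) (sg_top n) ` sg_verts n = {sg_right n + sg_top n}"
proof -
  have "sg_right n = sg_right n + sg_left" "sg_top n = sg_top n + sg_left"
    "sg_right n + sg_top n = sg_top n + sg_right n"
    by (auto simp: sg_left_def sg_right_def sg_top_def)
  then have mem: "sg_right n \<in> (+) (sg_right n) ` sg_verts n" "sg_top n \<in> (+) (sg_top n) ` sg_verts n"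
    "sg_right n + sg_top n \<in> (+) (sg_right n) ` sg_verts n"
    "sg_right n + sg_top n \<in> (+) (sg_top n) ` sg_verts n"
    using sg_corners[of n] by (metis imageI)+
  show "sg_verts n \<inter> (+) (sg_right n) ` sg_verts n = {sg_right n}"
    using sg_corners[of n] mem by (fastforce simp: sg_right_def dest: sg_verts_bound)
  show "sg_verts n \<inter> (+) (sg_top n) ` sg_verts n = {sg_top n}"
    using sg_corners[of n] mem by (fastforce simp: sg_top_def dest: sg_verts_bound)
  have "p = sg_right n + sg_top n"
    if p: "p \<in> (+) (sg_right n) ` sg_verts n" "p \<in> (+) (sg_top n) ` sg_verts n" for p
  proof -
    obtain i j k l where "(i, j) \<in> sg_verts n" "(k, l) \<in> sg_verts n"
      and eq: "p = sg_right n + (i, j)" "p = sg_top n + (k, l)"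
      using p by auto
    then have "i + j \<le> 2 ^ n" "k + l \<le> 2 ^ n" by (auto dest: sg_verts_bound)
    with eq show ?thesis by (auto simp: sg_right_def sg_top_def)
  qed
  then show "(+) (sg_right n) ` sg_verts n \<inter> (+) (sg_top n) ` sg_verts n = {sg_right n + sg_top n}"
    using mem by blast
qed


section \<open>Counting spanning subgraphs\<close>

definition sg_trees :: "nat \<Rightarrow> vertex set set set" where
  "sg_trees n = spanning_trees (sg_verts n) (sg_edges n)"

definition sg_two_trees :: "nat \<Rightarrow> vertex set set set" where
  "sg_two_trees n =
     spanning_two_trees (sg_verts n) (sg_edges n) {sg_top n} {sg_left, sg_right n}"

definition f_count :: "nat \<Rightarrow> nat" where
  "f_count n = card (sg_trees n)"

definition g_count :: "nat \<Rightarrow> nat" where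
  "g_count n = card (sg_two_trees n)"

definition f_deg :: "nat \<Rightarrow> nat \<Rightarrow> vertex \<Rightarrow> nat" where
  "f_deg i n x = card {T \<in> sg_trees n. incident_edges T x = i}"

definition g_deg :: "nat \<Rightarrow> nat \<Rightarrow> vertex \<Rightarrow> nat" where
  "g_deg i n x = card {T \<in> sg_two_trees n. incident_edges T x = i}"

definition F_prob :: "nat \<Rightarrow> nat \<Rightarrow> vertex \<Rightarrow> real" where
  "F_prob i n x = real (f_deg i n x) / real (f_count n)"

definition G_prob :: "nat \<Rightarrow> nat \<Rightarrow> vertex \<Rightarrow> real" where
  "G_prob i n x = real (g_deg i n x) / real (g_count n)"

end

(*
  A spanning subgraph of a graph in which every vertex is connected to one of three corners is a
  forest iff its number of edges plus its number of components equals the number of vertices, which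
  is the least possible value. So when T in SG(n+1) is cut into its three copies, T is such a forest
  iff the pieces are and the partitions of their corners fit together without creating a cycle; the
  latter depends on the partitions only. This gives a polynomial recursion for the numbers f, g, t
  of such forests with one, two and three components (g for each of the three ways to separate one
  corner from the others): f' = 6 f^2 g, g' = f^2 t + 7 f g^2, t' = 12 f g t + 14 g^3, whence
  f t = 3 g^2 for all n and g' = 10 f g^2. All edges at o lie in the lower-left copy, so the same
  recursion with the lower-left factor refined by the degree of o gives
  F_i' = (2 F_i + G_i) / 3 and G_i' = (3 F_i + 2 G_i) / 5, a matrix with eigenvalues 1 and 1/15.
*)
theory Submission
  imports Defs
begin

section \<open>Trees and pairs of trees, by reachability and edge counting\<close>

text \<open>Acyclicity is not local: a cycle may run around through all three copies. The number of
  edges is additive under merging, so every forest condition is turned into reachability plus an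
  edge count, and only reachability has to be followed from copy to copy. When the pieces of a given
  forest are examined, each of them is known only to have at least its minimal number of edges; the
  global count leaves no slack, so all these bounds are equalities. Refining by the degree at
  \<open>o\<close> breaks the symmetry between the corners: only the reflection exchanging the other
  two survives, and the forests that separate \<open>o\<close> become a class of their own. The
  system still closes, because once \<open>o\<close> is cut off from the two other corners of the
  lower-left copy it stays cut off after merging, and such pieces never contribute to F or G. The
  relation f t = 3 g^2 then removes t, the only remaining unknown.\<close>

definition reach :: "'v set set \<Rightarrow> ('v \<times> 'v) set" where
  "reach T = {(x, y). {x, y} \<in> T}\<^sup>*"

lemma reach_refl [simp]: "(x, x) \<in> reach T"
  by (simp add: reach_def)

lemma reach_trans: "(x, y) \<in> reach T \<Longrightarrow> (y, z) \<in> reach T \<Longrightarrow> (x, z) \<in> reach T"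
  unfolding reach_def by (rule rtrancl_trans)

lemma reach_sym: "(x, y) \<in> reach T \<Longrightarrow> (y, x) \<in> reach T"
proof -
  have "sym (reach T)"
    unfolding reach_def by (intro sym_rtrancl symI) (auto simp: insert_commute)
  then show "(x, y) \<in> reach T \<Longrightarrow> (y, x) \<in> reach T" by (rule symD)
qed

lemma reach_edge: "{x, y} \<in> T \<Longrightarrow> (x, y) \<in> reach T"
  unfolding reach_def by auto

lemma reach_mono: "(x, y) \<in> reach S \<Longrightarrow> S \<subseteq> T \<Longrightarrow> (x, y) \<in> reach T"
  unfolding reach_def by (erule rtrancl_mono[THEN subsetD, rotated]) auto

text \<open>The standard way below to bound reachability from above: exhibit a set that contains the
  start and that no edge leaves.\<close>

lemma reach_closed:
  assumes "(x, y) \<in> reach T" and "x \<in> W"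
    and "\<And>u v. (x, u) \<in> reach T \<Longrightarrow> u \<in> W \<Longrightarrow> {u, v} \<in> T \<Longrightarrow> v \<in> W"
  shows "y \<in> W"
  using assms(1) unfolding reach_def
proof (induction rule: rtrancl_induct)
  case (step u v)
  then show ?case using assms(3)[of u v] by (simp add: reach_def)
qed (rule assms(2))

text \<open>By injectivity an edge of the image at \<open>f z\<close> comes from an edge at
  \<open>z\<close>, so walks in a translated copy can be pulled back.\<close>

lemma reach_image:
  assumes "inj f"
  shows "(f x, f y) \<in> reach ((`) f ` T) \<longleftrightarrow> (x, y) \<in> reach T"
proof
  assume "(f x, f y) \<in> reach ((`) f ` T)"
  then have "f y \<in> {f z |z. (x, z) \<in> reach T}"
  proof (rule reach_closed)
    fix u v assume u: "u \<in> {f z |z. (x, z) \<in> reach T}" and "{u, v} \<in> (`) f ` T"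
    then obtain z e where z: "u = f z" "(x, z) \<in> reach T" and e: "e \<in> T" "f ` e = {u, v}"
      by auto
    then obtain w where "v = f w" by (metis imageE insertCI)
    then have "e = {z, w}"
      using e z assms by (metis image_empty image_insert inj_image_eq_iff)
    then show "v \<in> {f z |z. (x, z) \<in> reach T}"
      using e z \<open>v = f w\<close> by (auto intro: reach_trans reach_edge)
  qed auto
  then show "(x, y) \<in> reach T" using assms by (auto dest: injD)
next
  assume "(x, y) \<in> reach T"
  then have "y \<in> {y. (f x, f y) \<in> reach ((`) f ` T)}"
  proof (rule reach_closed)
    fix u v assume u: "u \<in> {y. (f x, f y) \<in> reach ((`) f ` T)}" and uv: "{u, v} \<in> T"
    have "{f u, f v} \<in> (`) f ` T" using imageI[OF uv, of "(`) f"] by simp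
    then show "v \<in> {y. (f x, f y) \<in> reach ((`) f ` T)}"
      using u reach_trans[of "f x" "f u" _ "f v"] reach_edge[of "f u" "f v"] by simp
  qed auto
  then show "(f x, f y) \<in> reach ((`) f ` T)" by simp
qed

text \<open>Grow from the roots \<open>C\<close>: as long as a vertex is missing, some edge of
  \<open>T\<close> leaves the set reached so far, since otherwise that set would be closed under
  edges. Adding such an edge and its new endpoint raises both counts by one.\<close>

lemma spanning_forest_exists:
  assumes "finite V" "C \<subseteq> V" and edges: "\<And>e. e \<in> T \<Longrightarrow> e \<subseteq> V"
    and reach: "\<And>v. v \<in> V \<Longrightarrow> \<exists>c\<in>C. (c, v) \<in> reach T"
  obtains T' where "T' \<subseteq> T" "card T' + card C = card V"
    "\<And>v. v \<in> V \<Longrightarrow> \<exists>c\<in>C. (c, v) \<in> reach T'"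
proof -
  have fin: "finite X" if "X \<subseteq> V" for X using that assms(1) finite_subset by blast
  \<comment> \<open>\<open>X\<close> is the set reached after \<open>m\<close> additions and
    \<open>S\<close> the edges used. That \<open>S\<close> stays inside \<open>X\<close> ensures
    that the next edge, which leaves \<open>X\<close>, is new.\<close>
  have "\<exists>X S. C \<subseteq> X \<and> X \<subseteq> V \<and> card X = card C + m \<and> finite S \<and> S \<subseteq> T \<and> \<Union>S \<subseteq> X
      \<and> card S = m \<and> (\<forall>v\<in>X. \<exists>c\<in>C. (c, v) \<in> reach S)"
    if "card C + m \<le> card V" for m
    using that
  proof (induction m)
    case 0
    have "\<exists>c\<in>C. (c, v) \<in> reach {}" if "v \<in> C" for v
      using that by (rule bexI[rotated]) (rule reach_refl)
    then show ?case using assms(2) by (intro exI[of _ C] exI[of _ "{}"]) simp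
  next
    case (Suc m)
    then have "card C + m \<le> card V" by simp
    from Suc.IH[OF this] obtain X S where X: "C \<subseteq> X" "X \<subseteq> V" "card X = card C + m" and S: "finite S" "S \<subseteq> T"
      "\<Union>S \<subseteq> X" "card S = m" "\<forall>v\<in>X. \<exists>c\<in>C. (c, v) \<in> reach S" by blast
    have "X \<noteq> V" using Suc.prems X(3) by auto
    then obtain w where w: "w \<in> V" "w \<notin> X" using X(2) by blast
    obtain c where c: "c \<in> C" "(c, w) \<in> reach T" using reach w by blast
    have "\<exists>u v. u \<in> X \<and> v \<notin> X \<and> {u, v} \<in> T"
    proof (rule ccontr)
      assume no: "\<nexists>u v. u \<in> X \<and> v \<notin> X \<and> {u, v} \<in> T"
      have "w \<in> X" using c(2) by (rule reach_closed) (use c X no in auto)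
      with w show False by simp
    qed
    then obtain u v where uv: "u \<in> X" "v \<notin> X" "{u, v} \<in> T" by blast
    have "v \<in> V" using edges[OF uv(3)] by simp
    have new: "{u, v} \<notin> S" using S(3) uv(2) by auto
    have "\<exists>c\<in>C. (c, x) \<in> reach (insert {u, v} S)" if "x \<in> insert v X" for x
    proof -
      have "\<exists>c\<in>C. (c, x) \<in> reach (insert {u, v} S)" if "x \<in> X" for x
        using S(5) that by (meson reach_mono subset_insertI)
      moreover from this[OF uv(1)] have "\<exists>c\<in>C. (c, v) \<in> reach (insert {u, v} S)"
        by (meson reach_trans reach_edge insertI1)
      ultimately show ?thesis using that by auto
    qed
    moreover have "card (insert v X) = card C + Suc m" "card (insert {u, v} S) = Suc m"
      using X(3) S(1,4) uv(2) new fin[OF X(2)] by simp_all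
    ultimately show ?case
      using X(1,2) S(1-3) uv \<open>v \<in> V\<close>
      by (intro exI[of _ "insert v X"] exI[of _ "insert {u, v} S"]) blast
  qed
  from this[of "card V - card C"] card_mono[OF assms(1,2)]
  obtain X S where X: "X \<subseteq> V" "card X = card V" and S: "S \<subseteq> T" "card S = card V - card C"
    "\<forall>v\<in>X. \<exists>c\<in>C. (c, v) \<in> reach S" by auto
  have "X = V" using X assms(1) card_subset_eq by blast
  with S card_mono[OF assms(1,2)] that[of S] show ?thesis by auto
qed

section \<open>Trees characterised by their number of edges\<close>

lemma finite_edges: "simple_graph V T \<Longrightarrow> finite T"
  by (rule finite_subset[of _ "Pow V"]) (auto simp: simple_graph_def)

text \<open>The lower bound whose equality case takes the place of acyclicity from here on.\<close>

lemma card_le_edges_plus_roots: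
  assumes "simple_graph V T" "C \<subseteq> V" "\<And>v. v \<in> V \<Longrightarrow> \<exists>c\<in>C. (c, v) \<in> reach T"
  shows "card V \<le> card T + card C"
proof -
  obtain T' where "T' \<subseteq> T" "card T' + card C = card V"
    using spanning_forest_exists[of V C T] assms by (metis simple_graph_def)
  with card_mono[OF finite_edges[OF assms(1)]] show ?thesis by (metis add_le_mono1)
qed

lemma graph_connected_iff_reach:
  assumes "r \<in> V"
  shows "graph_connected V T \<longleftrightarrow> (\<forall>v\<in>V. (r, v) \<in> reach T)"
  using assms by (auto simp: graph_connected_def simp flip: reach_def
    intro: reach_trans[OF reach_sym])

text \<open>\<open>graph_cycle\<close> asks for distinct vertices, so a walk has to be shortened to
  a simple path.\<close>

lemma reach_imp_distinct_path:
  assumes "(x, y) \<in> reach T"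
  shows "\<exists>vs. vs \<noteq> [] \<and> hd vs = x \<and> last vs = y \<and> distinct vs \<and> successively (\<lambda>u v. {u, v} \<in> T) vs"
  using assms unfolding reach_def
proof (induction rule: rtrancl_induct)
  case base
  show ?case by (intro exI[of _ "[x]"]) auto
next
  case (step y z)
  then obtain vs where vs: "vs \<noteq> []" "hd vs = x" "last vs = y" "distinct vs"
    "successively (\<lambda>u v. {u, v} \<in> T) vs" by blast
  show ?case
  proof (cases "z \<in> set vs")
    case True
    \<comment> \<open>The new vertex was visited before, so the path is cut off at that
      visit.\<close>
    then obtain as bs where "vs = as @ z # bs" by (meson split_list)
    with vs show ?thesis
      by (intro exI[of _ "as @ [z]"]) (auto simp: successively_append_iff hd_append split: if_splits)
  next
    case False
    with vs step show ?thesis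
      by (intro exI[of _ "vs @ [z]"]) (auto simp: successively_append_iff)
  qed
qed

lemma successively_imp_reach:
  assumes "successively (\<lambda>u v. {u, v} \<in> T) vs" "vs \<noteq> []"
  shows "(hd vs, last vs) \<in> reach T"
  using assms
proof (induction vs)
  case (Cons a vs)
  then show ?case by (cases vs) (auto intro: reach_trans[OF reach_edge])
qed simp

text \<open>If \<open>T\<close> has no cycle, it equals any spanning subset \<open>S\<close> with
  one edge fewer than vertices, because an extra edge would close a cycle with a path in
  \<open>S\<close>. Conversely, an edge on a cycle could be deleted without losing connectedness,
  against the lower bound on the number of edges.\<close>

lemma is_tree_iff_card:
  "is_tree V T \<longleftrightarrow> simple_graph V T \<and> graph_connected V T \<and> card T + 1 = card V"
proof -
  have "(\<nexists>vs. graph_cycle T vs) \<longleftrightarrow> card T + 1 = card V"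
    if simple: "simple_graph V T" and conn: "graph_connected V T"
  proof -
    obtain r where r: "r \<in> V" using conn by (auto simp: graph_connected_def)
    have finT: "finite T" using simple by (rule finite_edges)
    have reach_r: "(r, v) \<in> reach T" if "v \<in> V" for v
      using conn r that graph_connected_iff_reach by metis
    show ?thesis
    proof
      assume acyclic: "\<nexists>vs. graph_cycle T vs"
      obtain S where S: "S \<subseteq> T" "card S + 1 = card V" "\<And>v. v \<in> V \<Longrightarrow> (r, v) \<in> reach S"
        using spanning_forest_exists[of V "{r}" T] simple r reach_r
        by (auto simp: simple_graph_def)
      have "T \<subseteq> S"
      proof (rule subsetI, rule ccontr)
        fix e assume e: "e \<in> T" "e \<notin> S"
        then obtain u v where uv: "e = {u, v}" "u \<noteq> v" "u \<in> V" "v \<in> V"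
          using simple by (auto simp: simple_graph_def card_2_iff)
        have "(u, v) \<in> reach S" using S(3) uv by (meson reach_trans reach_sym)
        then obtain vs where vs: "vs \<noteq> []" "hd vs = u" "last vs = v" "distinct vs"
          "successively (\<lambda>u v. {u, v} \<in> S) vs" using reach_imp_distinct_path by metis
        \<comment> \<open>A path with one vertex would give \<open>u = v\<close>, and one with two
          vertices would put \<open>e\<close> into \<open>S\<close>.\<close>
        have "length vs \<ge> 3"
        proof (rule ccontr)
          assume "\<not> length vs \<ge> 3"
          then consider a where "vs = [a]" | a b where "vs = [a, b]"
            using vs(1) by (cases vs; cases "tl vs"; cases "tl (tl vs)") auto
          then show False using vs uv e by cases auto
        qed
        then have "graph_cycle T vs"
          using vs e uv S(1) by (auto simp: graph_cycle_def insert_commute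
            intro: successively_mono)
        with acyclic show False by blast
      qed
      with S show "card T + 1 = card V" by auto
    next
      assume card: "card T + 1 = card V"
      show "\<nexists>vs. graph_cycle T vs"
      proof
        assume "\<exists>vs. graph_cycle T vs"
        then obtain vs where len: "length vs \<ge> 3" and vs: "distinct vs"
          "successively (\<lambda>u v. {u, v} \<in> T) vs" and e: "{last vs, hd vs} \<in> T"
          by (auto simp: graph_cycle_def)
        let ?e = "{last vs, hd vs}"
        let ?S = "T - {?e}"
        have "successively (\<lambda>u v. {u, v} \<in> ?S) vs"
        proof -
          \<comment> \<open>No edge along the list is the closing edge: by distinctness a
            coincidence would force a list of length two.\<close>
          have "{vs ! i, vs ! Suc i} \<noteq> ?e" if "Suc i < length vs" for i
          proof -
            have "last vs = vs ! (length vs - 1)" "hd vs = vs ! 0"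
              using last_conv_nth[of vs] hd_conv_nth[of vs] len by force+
            moreover have "vs ! i \<noteq> vs ! (length vs - 1)" "vs ! Suc i \<noteq> vs ! 0 "
                "i \<noteq> 0 \<Longrightarrow> vs ! i \<noteq> vs ! 0"
                "i = 0 \<Longrightarrow> vs ! Suc i \<noteq> vs ! (length vs - 1)"
              using that len vs(1) by (subst nth_eq_iff_index_eq; linarith)+
            ultimately show ?thesis unfolding doubleton_eq_iff by metis
          qed
          with vs(2) show ?thesis by (auto simp: successively_conv_nth)
        qed
        then have "(hd vs, last vs) \<in> reach ?S"
          using len by (intro successively_imp_reach) auto
        \<comment> \<open>The rest of the cycle is a detour around the deleted edge.\<close>
        then have bridge: "(u, v) \<in> reach ?S" if "{u, v} = ?e" for u v
          using that by (auto simp: doubleton_eq_iff intro: reach_sym)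
        have "(r, v) \<in> reach ?S" if "v \<in> V" for v
        proof -
          have "v \<in> {v. (r, v) \<in> reach ?S}" using reach_r[OF that]
          proof (rule reach_closed)
            fix u v assume "u \<in> {v. (r, v) \<in> reach ?S}" "{u, v} \<in> T"
            then show "v \<in> {v. (r, v) \<in> reach ?S}"
              using bridge[of u v] reach_edge[of u v ?S] by (auto intro: reach_trans)
          qed simp
          then show ?thesis by simp
        qed
        then have "card V \<le> card ?S + card {r}"
          using r simple by (intro card_le_edges_plus_roots) (auto simp: simple_graph_def)
        moreover have "card ?S < card T" using e finT by (meson card_Diff1_less)
        ultimately show False using card by simp
      qed
    qed
  qed
  then show ?thesis by (auto simp: is_tree_def)
qed

lemma spanning_trees_iff:
  assumes "simple_graph V E" "r \<in> V"
  shows "T \<in> spanning_trees V E \<longleftrightarrow>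
    T \<subseteq> E \<and> (\<forall>v\<in>V. (r, v) \<in> reach T) \<and> card T + 1 = card V"
  using assms graph_connected_iff_reach[OF assms(2), of T]
  by (auto simp: spanning_trees_def is_tree_iff_card simple_graph_def)

text \<open>The two trees are the components of \<open>p\<close> and \<open>q\<close>. A single edge
  count for the whole of \<open>T\<close> suffices: each component needs at least its size minus one
  edges, and the total \<open>card V - 2\<close> makes both bounds sharp.\<close>

lemma spanning_two_trees_iff:
  assumes E: "simple_graph V E" and "P \<subseteq> V" "Q \<subseteq> V" and p: "p \<in> P" and q: "q \<in> Q"
  shows "T \<in> spanning_two_trees V E P Q \<longleftrightarrow>
    T \<subseteq> E \<and> (\<forall>v\<in>V. (p, v) \<in> reach T \<or> (q, v) \<in> reach T) \<and> (p, q) \<notin> reach T \<and>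
    (\<forall>x\<in>P. (p, x) \<in> reach T) \<and> (\<forall>x\<in>Q. (q, x) \<in> reach T) \<and> card T + 2 = card V"
    (is "_ \<longleftrightarrow> ?R")
proof
  assume "T \<in> spanning_two_trees V E P Q"
  then obtain A B S R where T: "T \<subseteq> E" and AB: "A \<inter> B = {}" "A \<union> B = V" and SR: "S \<union> R = T"
    and S: "is_tree A S" and R: "is_tree B R" and PQ: "P \<subseteq> A" "Q \<subseteq> B"
    by (auto simp: spanning_two_trees_def)
  have pA: "p \<in> A" and qB: "q \<in> B" using p q PQ by auto
  have sS: "simple_graph A S" and sR: "simple_graph B R"
    using S R by (auto simp: is_tree_def)
  have A: "(p, v) \<in> reach T" if "v \<in> A" for v
    using S that pA graph_connected_iff_reach[OF pA] SR
    by (auto simp: is_tree_def intro: reach_mono)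
  have B: "(q, v) \<in> reach T" if "v \<in> B" for v
    using R that qB graph_connected_iff_reach[OF qB] SR
    by (auto simp: is_tree_def intro: reach_mono)
  have "q \<in> A" if "(p, q) \<in> reach T"
    using that
  proof (rule reach_closed)
    fix u v assume "u \<in> A" "{u, v} \<in> T"
    \<comment> \<open>An edge with an endpoint in \<open>A\<close> is not inside \<open>B\<close>,
      so it belongs to \<open>S\<close> and both its endpoints are in \<open>A\<close>.\<close>
    moreover from this have "\<not> {u, v} \<subseteq> B" using AB by blast
    then have "{u, v} \<notin> R" using sR unfolding simple_graph_def by blast
    ultimately show "v \<in> A" using SR sS unfolding simple_graph_def by blast
  qed (rule pA)
  then have sep: "(p, q) \<notin> reach T" using qB AB by auto
  have "S \<inter> R = {}"
    using sS sR AB by (fastforce simp: simple_graph_def card_2_iff)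
  then have "card T = card S + card R"
    using SR finite_edges[OF sS] finite_edges[OF sR] card_Un_disjoint by blast
  moreover have "card V = card A + card B"
    using AB sS sR card_Un_disjoint by (metis simple_graph_def)
  ultimately have "card T + 2 = card V"
    using S R by (simp add: is_tree_iff_card)
  then show ?R using T A B sep PQ AB by blast
next
  assume R: ?R
  then have T: "T \<subseteq> E" and cov: "\<And>v. v \<in> V \<Longrightarrow> (p, v) \<in> reach T \<or> (q, v) \<in> reach T"
    and sep: "(p, q) \<notin> reach T" and card: "card T + 2 = card V" by auto
  define A where "A = {v \<in> V. (p, v) \<in> reach T}"
  define B where "B = {v \<in> V. (q, v) \<in> reach T}"
  define S where "S = {e \<in> T. e \<subseteq> A}"
  define R where "R = {e \<in> T. e \<subseteq> B}"
  have sT: "simple_graph V T" using E T by (auto simp: simple_graph_def)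
  have AB: "A \<inter> B = {}" "A \<union> B = V"
    using cov sep by (auto simp: A_def B_def dest: reach_sym reach_trans)
  have closed: "v \<in> A \<longleftrightarrow> u \<in> A" "v \<in> B \<longleftrightarrow> u \<in> B" if "{u, v} \<in> T" for u v
    using that sT reach_edge[OF that] reach_sym[OF reach_edge[OF that]]
    by (auto simp: A_def B_def simple_graph_def intro: reach_trans)
  have SR: "S \<union> R = T"
  proof -
    have "e \<in> S \<union> R" if "e \<in> T" for e
    proof -
      have "card e = 2" "e \<subseteq> V" using sT that by (auto simp: simple_graph_def)
      then obtain u v where "e = {u, v}" "u \<in> V" by (auto simp: card_2_iff)
      then show ?thesis using that closed[of u v] AB by (auto simp: S_def R_def)
    qed
    then show ?thesis by (auto simp: S_def R_def)
  qed
  have fin: "finite A" "finite B" using sT by (auto simp: A_def B_def simple_graph_def)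
  have sS: "simple_graph A S" and sR: "simple_graph B R"
    using sT fin by (auto simp: S_def R_def simple_graph_def)
  have pA: "p \<in> A" and qB: "q \<in> B" using p q assms by (auto simp: A_def B_def)
  have connA: "(p, v) \<in> reach S" if "v \<in> A" for v
  proof -
    have "(p, v) \<in> reach T" using that by (simp add: A_def)
    then have "v \<in> {v \<in> A. (p, v) \<in> reach S}"
    proof (rule reach_closed)
      fix u v assume "u \<in> {v \<in> A. (p, v) \<in> reach S}" "{u, v} \<in> T"
      then show "v \<in> {v \<in> A. (p, v) \<in> reach S}"
        using closed[of u v] reach_edge[of u v S] by (auto simp: S_def intro: reach_trans)
    qed (use pA in auto)
    then show ?thesis by simp
  qed
  have connB: "(q, v) \<in> reach R" if "v \<in> B" for v
  proof -
    have "(q, v) \<in> reach T" using that by (simp add: B_def)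
    then have "v \<in> {v \<in> B. (q, v) \<in> reach R}"
    proof (rule reach_closed)
      fix u v assume "u \<in> {v \<in> B. (q, v) \<in> reach R}" "{u, v} \<in> T"
      then show "v \<in> {v \<in> B. (q, v) \<in> reach R}"
        using closed[of u v] reach_edge[of u v R] by (auto simp: R_def intro: reach_trans)
    qed (use qB in auto)
    then show ?thesis by simp
  qed
  have "S \<inter> R = {}"
    using sS sR AB by (fastforce simp: simple_graph_def card_2_iff)
  then have "card T = card S + card R"
    using SR finite_edges[OF sS] finite_edges[OF sR] card_Un_disjoint by blast
  moreover have "card V = card A + card B"
    using AB fin card_Un_disjoint by metis
  \<comment> \<open>These two lower bounds add up to the known total, so both are
    equalities.\<close>
  moreover have "card A \<le> card S + card {p}" "card B \<le> card R + card {q}"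
    using sS sR pA qB connA connB by (intro card_le_edges_plus_roots; blast)+
  ultimately have "card S + 1 = card A" "card R + 1 = card B" using card by auto
  then have "is_tree A S" "is_tree B R"
    using sS sR connA connB graph_connected_iff_reach[OF pA] graph_connected_iff_reach[OF qB]
    by (auto simp: is_tree_iff_card)
  moreover have "P \<subseteq> A" "Q \<subseteq> B" using \<open>?R\<close> assms by (auto simp: A_def B_def)
  ultimately show "T \<in> spanning_two_trees V E P Q"
    using T AB SR unfolding spanning_two_trees_def by blast
qed

section \<open>Gluing graphs at corners\<close>

text \<open>Since \<open>overlap\<close> may be applied with \<open>i\<close> and \<open>j\<close>
  exchanged, a shared vertex is a corner of both pieces.\<close>

locale gluing =
  fixes I :: "'i set" and V C :: "'i \<Rightarrow> 'v set" and T :: "'i \<Rightarrow> 'v set set"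
  assumes edges_subset: "i \<in> I \<Longrightarrow> e \<in> T i \<Longrightarrow> e \<subseteq> V i"
    and corners_subset: "i \<in> I \<Longrightarrow> C i \<subseteq> V i"
    and overlap: "i \<in> I \<Longrightarrow> j \<in> I \<Longrightarrow> i \<noteq> j \<Longrightarrow> v \<in> V i \<Longrightarrow> v \<in> V j \<Longrightarrow> v \<in> C i"
begin

text \<open>A walk can leave a piece only through a corner of that piece, and the part of the walk
  before the first corner uses edges of this piece alone.\<close>

lemma reach_piece_corner:
  assumes i: "i \<in> I" "v \<in> V i" and d: "j \<in> I" "d \<in> C j" "(v, d) \<in> reach (\<Union>i\<in>I. T i)"
  shows "\<exists>c\<in>C i. (v, c) \<in> reach (T i)"
proof (rule ccontr)
  assume no: "\<not> ?thesis"
  have "d \<in> {u \<in> V i. (v, u) \<in> reach (T i)}" using d(3)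
  proof (rule reach_closed)
    fix u w assume u: "u \<in> {u \<in> V i. (v, u) \<in> reach (T i)}" and "{u, w} \<in> (\<Union>i\<in>I. T i)"
    then obtain k where k: "k \<in> I" "{u, w} \<in> T k" by blast
    have "u \<in> V k" using edges_subset[OF k] by simp
    then have "k = i" using u i k no overlap[of i k u] by auto
    then show "w \<in> {u \<in> V i. (v, u) \<in> reach (T i)}"
      using u k edges_subset[OF k] reach_trans[of v u "T i" w] reach_edge[of u w "T i"] by simp
  qed (use i in auto)
  moreover have "d \<in> C i" if "d \<in> V i"
    using that d i overlap[of i j d] corners_subset[of j] by (cases "i = j") auto
  ultimately show False using no by auto
qed

text \<open>Connections between corners in the union are generated by connections between corners
  inside single pieces, so a set of corners closed under the latter is closed under the
  former.\<close>

lemma reach_corners_closed: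
  assumes "(x, y) \<in> reach (\<Union>i\<in>I. T i)" and x: "k \<in> I" "x \<in> C k" "x \<in> S"
    and y: "l \<in> I" "y \<in> C l"
    and closed: "\<And>i c d. i \<in> I \<Longrightarrow> c \<in> C i \<Longrightarrow> d \<in> C i \<Longrightarrow> (c, d) \<in> reach (T i) \<Longrightarrow> c \<in> S \<Longrightarrow> d \<in> S"
  shows "y \<in> S"
proof -
  \<comment> \<open>The set \<open>S\<close> extended to the interiors: the vertices that some
    corner in \<open>S\<close> reaches within one piece. No edge of the union leaves it.\<close>
  let ?W = "{u. \<exists>i\<in>I. u \<in> V i \<and> (\<exists>c\<in>C i. c \<in> S \<and> (c, u) \<in> reach (T i))}"
  have "y \<in> ?W" using assms(1)
  proof (rule reach_closed)
    show "x \<in> ?W" using x corners_subset[of k] reach_refl[of x] by blast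
  next
    fix u v assume "u \<in> ?W" "{u, v} \<in> (\<Union>i\<in>I. T i)"
    then obtain i c j where i: "i \<in> I" "u \<in> V i" "c \<in> C i" "c \<in> S" "(c, u) \<in> reach (T i)"
      and j: "j \<in> I" "{u, v} \<in> T j" by blast
    have uv: "u \<in> V j" "v \<in> V j" using edges_subset[OF j] by auto
    have "\<exists>c\<in>C j. c \<in> S \<and> (c, u) \<in> reach (T j)"
    proof (cases "i = j")
      \<comment> \<open>The walk changes from piece \<open>i\<close> to piece \<open>j\<close> at
        \<open>u\<close>, which is a corner of both; hence \<open>u\<close> is itself in
        \<open>S\<close> and is the new starting corner.\<close>
      case False
      then have "u \<in> C i" "u \<in> C j" using overlap i j uv by blast+
      then show ?thesis using closed[OF i(1,3) _ i(5,4)] reach_refl[of u] by blast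
    qed (use i in auto)
    then show "v \<in> ?W" using j uv reach_trans[of _ u "T j" v] reach_edge[OF j(2)] by blast
  qed
  then obtain i c where i: "i \<in> I" "y \<in> V i" "c \<in> C i" "c \<in> S" "(c, y) \<in> reach (T i)" by blast
  moreover have "y \<in> C i" using i y overlap[of i l y] corners_subset[of l] by (cases "i = l") auto
  ultimately show ?thesis using closed by blast
qed

end

section \<open>Forests of the gasket and their corner partitions\<close>

text \<open>The partition of the corners \<open>o\<close>, \<open>a\<^sub>n\<close>, \<open>b\<^sub>n\<close> into components is recorded by whether
  \<open>o a\<^sub>n\<close>, \<open>o b\<^sub>n\<close> and \<open>a\<^sub>n b\<^sub>n\<close> are connected; five of the eight triples occur. The arguments
  \<open>(x1, y1, z1)\<close>, \<open>(x2, y2, z2)\<close>, \<open>(x3, y3, z3)\<close> below belong to the lower-left, lower-right and top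
  copy, and the disjunctions list the simple routes through the copies.\<close>

type_synonym state = "bool \<times> bool \<times> bool"

definition corner_state :: "nat \<Rightarrow> vertex set set \<Rightarrow> state" where
  "corner_state n T = ((sg_left, sg_right n) \<in> reach T, (sg_left, sg_top n) \<in> reach T,
     (sg_right n, sg_top n) \<in> reach T)"

fun blocks :: "state \<Rightarrow> nat" where
  "blocks (x, y, z) = (if x \<and> y \<and> z then 1 else if x \<or> y \<or> z then 2 else 3)"

fun is_equiv :: "state \<Rightarrow> bool" where
  "is_equiv (x, y, z) \<longleftrightarrow> (x \<and> y \<longrightarrow> z) \<and> (x \<and> z \<longrightarrow> y) \<and> (y \<and> z \<longrightarrow> x)"

fun glue :: "state \<Rightarrow> state \<Rightarrow> state \<Rightarrow> state" where
  "glue (x1, y1, z1) (x2, y2, z2) (x3, y3, z3) =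
     (x1 \<and> x2 \<or> y1 \<and> x3 \<and> z2, y1 \<and> y3 \<or> x1 \<and> y2 \<and> z3, z2 \<and> z3 \<or> x2 \<and> z1 \<and> y3)"

text \<open>Each of the three glued vertices is connected to one of the three outmost vertices.\<close>

fun rooted :: "state \<Rightarrow> state \<Rightarrow> state \<Rightarrow> bool" where
  "rooted (x1, y1, z1) (x2, y2, z2) (x3, y3, z3) \<longleftrightarrow>
     (x1 \<or> x2 \<or> z1 \<and> y3 \<or> z1 \<and> x3 \<and> z2 \<or> y2 \<and> z3 \<or> y2 \<and> x3 \<and> y1) \<and>
     (y1 \<or> y3 \<or> z1 \<and> x2 \<or> z1 \<and> y2 \<and> z3 \<or> x3 \<and> z2 \<or> x3 \<and> y2 \<and> x1) \<and>
     (z2 \<or> z3 \<or> y2 \<and> x1 \<or> y2 \<and> z1 \<and> y3 \<or> x3 \<and> y1 \<or> x3 \<and> z1 \<and> x2)"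

lemma is_equiv_corner_state: "is_equiv (corner_state n T)"
  unfolding corner_state_def is_equiv.simps by (meson reach_trans reach_sym)

lemma is_equiv_cases:
  assumes "is_equiv s"
  obtains "s = (True, True, True)" | "s = (True, False, False)" | "s = (False, True, False)"
    | "s = (False, False, True)" | "s = (False, False, False)"
proof (cases s)
  case (fields x y z)
  with assms that show ?thesis by (cases x; cases y; cases z) simp_all
qed

text \<open>The rank inequality that forces all three copies to be extremal in \<open>forests_merge\<close>.\<close>

lemma blocks_glue:
  assumes "is_equiv s1" "is_equiv s2" "is_equiv s3" "rooted s1 s2 s3"
  shows "blocks s1 + blocks s2 + blocks s3 \<le> 3 + blocks (glue s1 s2 s3)"
  using assms(4)
  by (cases rule: is_equiv_cases[OF assms(1)]; cases rule: is_equiv_cases[OF assms(2)];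
      cases rule: is_equiv_cases[OF assms(3)]) simp_all

section \<open>Subgraphs of the next gasket as merged triples\<close>

definition sg_corner_set :: "nat \<Rightarrow> vertex set" where
  "sg_corner_set n = {sg_left, sg_right n, sg_top n}"

text \<open>Under this condition the components of \<open>T\<close> on the gasket correspond to the
  blocks of its corner partition: none is hidden in the interior, where later merges could not
  attach it.\<close>

definition covers :: "nat \<Rightarrow> vertex set set \<Rightarrow> bool" where
  "covers n T \<longleftrightarrow> (\<forall>v\<in>sg_verts n. \<exists>c\<in>sg_corner_set n. (v, c) \<in> reach T)"

abbreviation shift :: "vertex \<Rightarrow> vertex set set \<Rightarrow> vertex set set" where
  "shift d T \<equiv> (`) ((+) d) ` T"

text \<open>All three arguments are given in the coordinates of \<open>SG(n)\<close> itself, so that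
  triples are counted by products of the same numbers.\<close>

definition merge :: "nat \<Rightarrow> vertex set set \<Rightarrow> vertex set set \<Rightarrow> vertex set set \<Rightarrow> vertex set set" where
  "merge n T1 T2 T3 = T1 \<union> shift (sg_right n) T2 \<union> shift (sg_top n) T3"

lemma sg_edges_Suc_merge: "sg_edges (Suc n) = merge n (sg_edges n) (sg_edges n) (sg_edges n)"
  by (simp add: merge_def)

lemma simple_graph_sg: "simple_graph (sg_verts n) (sg_edges n)"
proof (induction n)
  case 0
  show ?case by (auto simp: simple_graph_def sg_left_def sg_right_def sg_top_def)
next
  case (Suc n)
  have card: "card ((+) d ` e) = card e" for d :: vertex and e
    by (rule card_image) (auto simp: inj_on_def)
  from Suc show ?case
    unfolding simple_graph_def by (auto simp: card)
qed

lemma sg_left_eq_0: "sg_left = 0"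
  by (simp add: sg_left_def zero_prod_def)

lemma sg_Suc: "sg_right (Suc n) = sg_right n + sg_right n" "sg_top (Suc n) = sg_top n + sg_top n"
  by (auto simp: sg_right_def sg_top_def)

lemma inj_add_vertex: "inj ((+) (d :: vertex))"
  by (auto simp: inj_on_def)

lemma reach_shift: "(d + x, d + y) \<in> reach (shift d T) \<longleftrightarrow> (x, y) \<in> reach T"
  by (rule reach_image[OF inj_add_vertex])

lemma reach_triple:
  assumes "(u, v) \<in> reach T \<Longrightarrow> u \<in> S \<longleftrightarrow> v \<in> S" "(u, w) \<in> reach T \<Longrightarrow> u \<in> S \<longleftrightarrow> w \<in> S"
    "(v, w) \<in> reach T \<Longrightarrow> v \<in> S \<longleftrightarrow> w \<in> S"
    and "c \<in> {u, v, w}" "d \<in> {u, v, w}" "(c, d) \<in> reach T" "c \<in> S"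
  shows "d \<in> S"
  using assms reach_sym[of c d T] by auto

locale sg_merge =
  fixes n :: nat and T1 T2 T3 :: "vertex set set"
  assumes sub: "T1 \<subseteq> sg_edges n" "T2 \<subseteq> sg_edges n" "T3 \<subseteq> sg_edges n"
begin

text \<open>Pieces are indexed by their translation vectors. These vectors are the three corners of
  \<open>SG(n)\<close>, with \<open>sg_left\<close> the zero vector, which is why
  \<open>sg_corner_set n\<close> serves as the index set.\<close>

definition piece :: "vertex \<Rightarrow> vertex set set" where
  "piece d = shift d (if d = sg_left then T1 else if d = sg_right n then T2 else T3)"

lemma corners_neq: "sg_left \<noteq> sg_right n" "sg_left \<noteq> sg_top n" "sg_right n \<noteq> sg_top n"
  by (auto simp: sg_left_def sg_right_def sg_top_def)

lemma pieces: "piece sg_left = T1" "piece (sg_right n) = shift (sg_right n) T2"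
  "piece (sg_top n) = shift (sg_top n) T3"
  using corners_neq by (auto simp: piece_def sg_left_eq_0)

lemma pieces_Union: "(\<Union>d\<in>sg_corner_set n. piece d) = merge n T1 T2 T3"
  by (auto simp: pieces sg_corner_set_def merge_def)

sublocale gluing "sg_corner_set n" "\<lambda>d. (+) d ` sg_verts n"
  "\<lambda>d. {d, d + sg_right n, d + sg_top n}" piece
proof
  fix d e assume "d \<in> sg_corner_set n" "e \<in> piece d"
  then obtain e' where "e = (+) d ` e'" "e' \<in> sg_edges n"
    using sub by (auto simp: piece_def split: if_splits)
  then show "e \<subseteq> (+) d ` sg_verts n"
    using simple_graph_sg[of n] by (auto simp: simple_graph_def)
next
  fix d assume "d \<in> sg_corner_set n"
  show "{d, d + sg_right n, d + sg_top n} \<subseteq> (+) d ` sg_verts n"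
    using sg_corners(2,3)[of n] imageI[OF sg_corners(1)[of n], of "(+) d"]
    by (simp add: sg_left_eq_0)
next
  fix d d' v assume d: "d \<in> sg_corner_set n" "d' \<in> sg_corner_set n" "d \<noteq> d'"
    and v: "v \<in> (+) d ` sg_verts n" "v \<in> (+) d' ` sg_verts n"
  have l: "(+) sg_left ` sg_verts n = sg_verts n" by (simp add: sg_left_eq_0)
  have rt: "v = sg_right n + sg_top n"
    if "v \<in> (+) (sg_right n) ` sg_verts n" "v \<in> (+) (sg_top n) ` sg_verts n"
    using that sg_right_Int_top[of n] by blast
  have lr: "v = sg_right n" if "v \<in> sg_verts n" "v \<in> (+) (sg_right n) ` sg_verts n"
    using that sg_left_Int_right[of n] by blast
  have lt: "v = sg_top n" if "v \<in> sg_verts n" "v \<in> (+) (sg_top n) ` sg_verts n"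
    using that sg_left_Int_top[of n] by blast
  have at_left: "{sg_left, sg_left + sg_right n, sg_left + sg_top n} = {sg_left, sg_right n, sg_top n}"
    by (simp add: sg_left_eq_0)
  consider "d = sg_left" "d' = sg_right n" | "d = sg_left" "d' = sg_top n"
    | "d = sg_right n" "d' = sg_left" | "d = sg_right n" "d' = sg_top n"
    | "d = sg_top n" "d' = sg_left" | "d = sg_top n" "d' = sg_right n"
    using d unfolding sg_corner_set_def by blast
  then show "v \<in> {d, d + sg_right n, d + sg_top n}"
  proof cases
    case 1
    have "v = sg_right n" by (rule lr) (use v 1 l in metis)+
    then show ?thesis unfolding 1 at_left by simp
  next
    case 2
    have "v = sg_top n" by (rule lt) (use v 2 l in metis)+
    then show ?thesis unfolding 2 at_left by simp
  next
    case 3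
    have "v = sg_right n" by (rule lr) (use v 3 l in metis)+
    then show ?thesis unfolding 3 by simp
  next
    case 4
    have "v = sg_right n + sg_top n" by (rule rt) (use v 4 in metis)+
    then show ?thesis unfolding 4 by simp
  next
    case 5
    have "v = sg_top n" by (rule lt) (use v 5 l in metis)+
    then show ?thesis unfolding 5 by simp
  next
    case 6
    have "v = sg_right n + sg_top n" by (rule rt) (use v 6 in metis)+
    then show ?thesis unfolding 6 by (simp add: add.commute[of "sg_right n"])
  qed
qed

text \<open>\<open>a\<close>, \<open>b\<close> are the new outmost vertices; \<open>p\<close>, \<open>q\<close>, \<open>s\<close> are the glued vertices on the bottom,
  left and right side.\<close>

abbreviation "T \<equiv> merge n T1 T2 T3"
abbreviation "orig \<equiv> sg_left"
abbreviation "p \<equiv> sg_right n"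
abbreviation "q \<equiv> sg_top n"
abbreviation "s \<equiv> sg_right n + sg_top n"
abbreviation "a \<equiv> sg_right (Suc n)"
abbreviation "b \<equiv> sg_top (Suc n)"

text \<open>To refute a connection it is enough to give a set \<open>S\<close> of corners respecting
  nine local connections. Those of \<open>T2\<close> and \<open>T3\<close> are stated before
  translation: \<open>orig\<close>, \<open>p\<close>, \<open>q\<close> become \<open>p\<close>,
  \<open>a\<close>, \<open>s\<close> in the lower-right copy and \<open>q\<close>, \<open>s\<close>,
  \<open>b\<close> in the top copy.\<close>

lemma reach_closed_corners:
  assumes "(x, y) \<in> reach T" "x \<in> {orig, p, q, s, a, b}" "y \<in> {orig, p, q, s, a, b}" "x \<in> S"
    and "(orig, p) \<in> reach T1 \<Longrightarrow> orig \<in> S \<longleftrightarrow> p \<in> S" "(orig, q) \<in> reach T1 \<Longrightarrow> orig \<in> S \<longleftrightarrow> q \<in> S"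
      "(p, q) \<in> reach T1 \<Longrightarrow> p \<in> S \<longleftrightarrow> q \<in> S"
    and "(orig, p) \<in> reach T2 \<Longrightarrow> p \<in> S \<longleftrightarrow> a \<in> S" "(orig, q) \<in> reach T2 \<Longrightarrow> p \<in> S \<longleftrightarrow> s \<in> S"
      "(p, q) \<in> reach T2 \<Longrightarrow> a \<in> S \<longleftrightarrow> s \<in> S"
    and "(orig, p) \<in> reach T3 \<Longrightarrow> q \<in> S \<longleftrightarrow> s \<in> S" "(orig, q) \<in> reach T3 \<Longrightarrow> q \<in> S \<longleftrightarrow> b \<in> S"
      "(p, q) \<in> reach T3 \<Longrightarrow> s \<in> S \<longleftrightarrow> b \<in> S"
  shows "y \<in> S"
proof -
  have corner: "\<exists>d\<in>sg_corner_set n. v \<in> {d, d + p, d + q}" if "v \<in> {orig, p, q, s, a, b}" for v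
    using that by (auto simp: sg_corner_set_def sg_Suc sg_left_eq_0)
  obtain k where k: "k \<in> sg_corner_set n" "x \<in> {k, k + p, k + q}" using corner assms(2) by blast
  obtain l where l: "l \<in> sg_corner_set n" "y \<in> {l, l + p, l + q}" using corner assms(3) by blast
  show ?thesis
  proof (rule reach_corners_closed[OF _ k assms(4) l])
    show "(x, y) \<in> reach (\<Union>d\<in>sg_corner_set n. piece d)" using assms(1) by (simp add: pieces_Union)
  next
    fix i c d assume i: "i \<in> sg_corner_set n" and cd: "c \<in> {i, i + p, i + q}" "d \<in> {i, i + p, i + q}"
      "(c, d) \<in> reach (piece i)" "c \<in> S"
    have shifted: "(i, i + v) \<in> reach (shift i X) \<longleftrightarrow> (orig, v) \<in> reach X" for v X
      using reach_shift[of i 0 v X] by (simp add: sg_left_eq_0)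
    consider "i = orig" | "i = p" | "i = q" using i by (auto simp: sg_corner_set_def)
    then show "d \<in> S"
    proof cases
      case 1
      show ?thesis
      proof (rule reach_triple[OF _ _ _ cd])
        show "i \<in> S \<longleftrightarrow> i + p \<in> S" if "(i, i + p) \<in> reach (piece i)"
          using assms(5) that unfolding 1 pieces[unfolded sg_left_eq_0] sg_left_eq_0 add_0_left .
        show "i \<in> S \<longleftrightarrow> i + q \<in> S" if "(i, i + q) \<in> reach (piece i)"
          using assms(6) that unfolding 1 pieces[unfolded sg_left_eq_0] sg_left_eq_0 add_0_left .
        show "i + p \<in> S \<longleftrightarrow> i + q \<in> S" if "(i + p, i + q) \<in> reach (piece i)"
          using assms(7) that unfolding 1 pieces[unfolded sg_left_eq_0] sg_left_eq_0 add_0_left .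
      qed
    next
      case 2
      show ?thesis
      proof (rule reach_triple[OF _ _ _ cd])
        show "i \<in> S \<longleftrightarrow> i + p \<in> S" if "(i, i + p) \<in> reach (piece i)"
          using assms(8) that unfolding 2 pieces shifted[unfolded 2] reach_shift sg_Suc .
        show "i \<in> S \<longleftrightarrow> i + q \<in> S" if "(i, i + q) \<in> reach (piece i)"
          using assms(9) that unfolding 2 pieces shifted[unfolded 2] reach_shift sg_Suc .
        show "i + p \<in> S \<longleftrightarrow> i + q \<in> S" if "(i + p, i + q) \<in> reach (piece i)"
          using assms(10) that unfolding 2 pieces shifted[unfolded 2] reach_shift sg_Suc .
      qed
    next
      case 3
      show ?thesis
      proof (rule reach_triple[OF _ _ _ cd])
        show "i \<in> S \<longleftrightarrow> i + p \<in> S" if "(i, i + p) \<in> reach (piece i)"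
          using assms(11) that unfolding 3 pieces shifted[unfolded 3] reach_shift sg_Suc unfolding add.commute[of q p] .
        show "i \<in> S \<longleftrightarrow> i + q \<in> S" if "(i, i + q) \<in> reach (piece i)"
          using assms(12) that unfolding 3 pieces shifted[unfolded 3] reach_shift sg_Suc unfolding add.commute[of q p] .
        show "i + p \<in> S \<longleftrightarrow> i + q \<in> S" if "(i + p, i + q) \<in> reach (piece i)"
          using assms(13) that unfolding 3 pieces shifted[unfolded 3] reach_shift sg_Suc unfolding add.commute[of q p] .
      qed
    qed
  qed
qed

lemma reach_merge:
  "(u, v) \<in> reach T1 \<Longrightarrow> (u, v) \<in> reach T"
  "(u, v) \<in> reach T2 \<Longrightarrow> (p + u, p + v) \<in> reach T"
  "(u, v) \<in> reach T3 \<Longrightarrow> (q + u, q + v) \<in> reach T"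
proof -
  show "(u, v) \<in> reach T" if "(u, v) \<in> reach T1"
    using that by (rule reach_mono) (auto simp: merge_def)
  show "(p + u, p + v) \<in> reach T" if "(u, v) \<in> reach T2"
    using that unfolding reach_shift[symmetric, of u v _ p] by (rule reach_mono) (auto simp: merge_def)
  show "(q + u, q + v) \<in> reach T" if "(u, v) \<in> reach T3"
    using that unfolding reach_shift[symmetric, of u v _ q] by (rule reach_mono) (auto simp: merge_def)
qed

lemma reach_pieces:
  "(orig, p) \<in> reach T1 \<Longrightarrow> (orig, p) \<in> reach T" "(orig, q) \<in> reach T1 \<Longrightarrow> (orig, q) \<in> reach T"
  "(p, q) \<in> reach T1 \<Longrightarrow> (p, q) \<in> reach T"
  "(orig, p) \<in> reach T2 \<Longrightarrow> (p, a) \<in> reach T" "(orig, q) \<in> reach T2 \<Longrightarrow> (p, s) \<in> reach T"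
  "(p, q) \<in> reach T2 \<Longrightarrow> (a, s) \<in> reach T"
  "(orig, p) \<in> reach T3 \<Longrightarrow> (q, s) \<in> reach T" "(orig, q) \<in> reach T3 \<Longrightarrow> (q, b) \<in> reach T"
  "(p, q) \<in> reach T3 \<Longrightarrow> (s, b) \<in> reach T"
  using reach_merge(1)[of orig p] reach_merge(1)[of orig q] reach_merge(1)[of p q]
    reach_merge(2)[of orig p] reach_merge(2)[of orig q] reach_merge(2)[of p q]
    reach_merge(3)[of orig p] reach_merge(3)[of orig q] reach_merge(3)[of p q]
  by (simp_all add: sg_Suc sg_left_eq_0 add.commute[of q p])

end

text \<open>Two copies share a single vertex, and an edge has two.\<close>

lemma sg_edges_disjoint:
  "sg_edges n \<inter> shift (sg_right n) (sg_edges n) = {}"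
  "sg_edges n \<inter> shift (sg_top n) (sg_edges n) = {}"
  "shift (sg_right n) (sg_edges n) \<inter> shift (sg_top n) (sg_edges n) = {}"
proof -
  have E: "e \<subseteq> sg_verts n" "card e = 2" if "e \<in> sg_edges n" for e
    using that simple_graph_sg[of n] by (auto simp: simple_graph_def)
  have S: "e \<subseteq> (+) d ` sg_verts n" "card e = 2" if e: "e \<in> shift d (sg_edges n)" for e d
  proof -
    obtain e' where e': "e' \<in> sg_edges n" "e = (+) d ` e'" using e by blast
    then show "e \<subseteq> (+) d ` sg_verts n" using E(1) by blast
    show "card e = 2" unfolding e'(2) using E(2)[OF e'(1)] by (simp add: card_image inj_on_def)
  qed
  have no: "\<not> e \<subseteq> {v}" if "card e = 2" for e :: "vertex set" and v
    using that card_mono[of "{v}" e] by (intro notI) simp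
  have "False" if "e \<in> sg_edges n" "e \<in> shift (sg_right n) (sg_edges n)" for e
    using E(1)[OF that(1)] S(1)[OF that(2)] no[OF E(2)[OF that(1)], of "sg_right n"]
    unfolding sg_left_Int_right[symmetric] by blast
  then show "sg_edges n \<inter> shift (sg_right n) (sg_edges n) = {}" by blast
  have "False" if "e \<in> sg_edges n" "e \<in> shift (sg_top n) (sg_edges n)" for e
    using E(1)[OF that(1)] S(1)[OF that(2)] no[OF E(2)[OF that(1)], of "sg_top n"]
    unfolding sg_left_Int_top[symmetric] by blast
  then show "sg_edges n \<inter> shift (sg_top n) (sg_edges n) = {}" by blast
  have "False" if "e \<in> shift (sg_right n) (sg_edges n)" "e \<in> shift (sg_top n) (sg_edges n)" for e
    using S(1)[OF that(1)] S(1)[OF that(2)] no[OF S(2)[OF that(1)], of "sg_right n + sg_top n"]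
    unfolding sg_right_Int_top[symmetric] by blast
  then show "shift (sg_right n) (sg_edges n) \<inter> shift (sg_top n) (sg_edges n) = {}" by blast
qed

lemma finite_sg_verts: "finite (sg_verts n)"
  using simple_graph_sg by (auto simp: simple_graph_def)

text \<open>Three pairs of vertices are identified. This 3 cancels the one in
  \<open>blocks_glue\<close>.\<close>

lemma card_sg_verts_Suc: "card (sg_verts (Suc n)) + 3 = 3 * card (sg_verts n)"
proof -
  let ?R = "(+) (sg_right n) ` sg_verts n" and ?U = "(+) (sg_top n) ` sg_verts n"
  have c: "card ((+) d ` sg_verts n) = card (sg_verts n)" for d :: vertex
    by (rule card_image) (simp add: inj_on_def)
  have "card (sg_verts n) + card ?R = card (sg_verts n \<union> ?R) + card (sg_verts n \<inter> ?R)"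
    using finite_sg_verts by (intro card_Un_Int) auto
  moreover have "card (sg_verts n \<union> ?R) + card ?U =
      card (sg_verts n \<union> ?R \<union> ?U) + card ((sg_verts n \<union> ?R) \<inter> ?U)"
    using finite_sg_verts by (intro card_Un_Int) auto
  moreover have "(sg_verts n \<union> ?R) \<inter> ?U = {sg_top n, sg_right n + sg_top n}"
    unfolding Int_Un_distrib2 sg_left_Int_top sg_right_Int_top by auto
  moreover have "card {sg_top n, sg_right n + sg_top n} = 2"
    by (auto simp: sg_top_def sg_right_def)
  ultimately show ?thesis unfolding c sg_left_Int_right by simp
qed

text \<open>One corner from each block of the corner partition gives a set of roots reaching every
  vertex.\<close>

lemma card_le_edges_plus_blocks:
  assumes "T \<subseteq> sg_edges n" "covers n T"
  shows "card (sg_verts n) \<le> card T + blocks (corner_state n T)"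
proof -
  have simple: "simple_graph (sg_verts n) T"
    using assms(1) simple_graph_sg[of n] by (auto simp: simple_graph_def)
  have covered: "(sg_left, v) \<in> reach T \<or> (sg_right n, v) \<in> reach T \<or> (sg_top n, v) \<in> reach T"
    if "v \<in> sg_verts n" for v
    using that assms(2) reach_sym by (fastforce simp: covers_def sg_corner_set_def)
  have bound: "card (sg_verts n) \<le> card T + card C"
    if C: "C \<subseteq> sg_corner_set n" "\<forall>c\<in>sg_corner_set n. \<exists>d\<in>C. (d, c) \<in> reach T" for C
  proof (rule card_le_edges_plus_roots[OF simple])
    show "C \<subseteq> sg_verts n" using C(1) sg_corners[of n] by (auto simp: sg_corner_set_def)
    fix v assume "v \<in> sg_verts n"
    then obtain c where c: "c \<in> sg_corner_set n" "(c, v) \<in> reach T"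
      using covered unfolding sg_corner_set_def by blast
    obtain d where "d \<in> C" "(d, c) \<in> reach T" using C(2) c(1) by blast
    then show "\<exists>c\<in>C. (c, v) \<in> reach T" using reach_trans[OF _ c(2), of d] by blast
  qed
  have card2: "card {x, y :: vertex} \<le> 2" and card3: "card {x, y, z :: vertex} \<le> 3" for x y z
    by (simp_all add: card_insert_if)
  show ?thesis
  proof (cases rule: is_equiv_cases[OF is_equiv_corner_state[of n T]])
    case 1
    then show ?thesis using bound[of "{sg_left}"] by (simp add: corner_state_def sg_corner_set_def)
  next
    case 2
    then show ?thesis using bound[of "{sg_left, sg_top n}"] card2[of sg_left "sg_top n"]
      by (simp add: corner_state_def sg_corner_set_def)
  next
    case 3
    then show ?thesis using bound[of "{sg_left, sg_right n}"] card2[of sg_left "sg_right n"]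
      by (simp add: corner_state_def sg_corner_set_def)
  next
    case 4
    then show ?thesis using bound[of "{sg_left, sg_right n}"] card2[of sg_left "sg_right n"]
      by (simp add: corner_state_def sg_corner_set_def)
  next
    case 5
    then show ?thesis using bound[of "{sg_left, sg_right n, sg_top n}"] card3[of sg_left "sg_right n" "sg_top n"]
      by (simp add: corner_state_def sg_corner_set_def)
  qed
qed

section \<open>Edge count, corner partition and covering property of a merge\<close>

context sg_merge
begin

lemma card_merge: "card T = card T1 + card T2 + card T3"
proof -
  have fin: "finite X" if "X \<subseteq> sg_edges n" for X
    using that finite_edges[OF simple_graph_sg] finite_subset by blast
  have "inj ((`) ((+) d))" for d :: vertex by (simp add: inj_def inj_image_eq_iff[OF inj_add_vertex])
  then have c: "card (shift d X) = card X" for d X by (meson card_image inj_on_subset subset_UNIV)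
  have disj: "X \<inter> Y = {}" if "X \<subseteq> A" "Y \<subseteq> B" "A \<inter> B = {}" for X Y A B :: "vertex set set"
    using that by blast
  note sub' = sub(1) image_mono[OF sub(2), of "(`) ((+) p)"] image_mono[OF sub(3), of "(`) ((+) q)"]
  have "T1 \<inter> shift p T2 = {}" "(T1 \<union> shift p T2) \<inter> shift q T3 = {}"
    unfolding Int_Un_distrib2
      disj[OF sub'(1,2) sg_edges_disjoint(1)] disj[OF sub'(1,3) sg_edges_disjoint(2)]
      disj[OF sub'(2,3) sg_edges_disjoint(3)] by simp_all
  then show ?thesis
    using fin[OF sub(1)] fin[OF sub(2)] fin[OF sub(3)]
    unfolding merge_def by (simp add: card_Un_disjoint c)
qed

lemma incident_edges_merge: "incident_edges T sg_left = incident_edges T1 sg_left"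
proof -
  have "sg_left \<noteq> p + v" "sg_left \<noteq> q + v" for v
    by (cases v; simp add: sg_left_def sg_right_def sg_top_def)+
  then have "{e \<in> T. sg_left \<in> e} = {e \<in> T1. sg_left \<in> e}"
    by (auto simp: merge_def)
  then show ?thesis by (simp add: incident_edges_def)
qed

lemma distinct_corners: "distinct [orig, p, q, s, a, b]"
  by (auto simp: sg_left_def sg_right_def sg_top_def)

text \<open>The set of corners is encoded by six truth values, one for each vertex, so that being
  closed becomes a purely propositional condition on the nine entries of the corner states.\<close>

lemma reach_closed_corners_bool:
  assumes "(x, v) \<in> reach T" "x \<in> {orig, p, q, s, a, b}" and v: "v \<in> {orig, p, q, s, a, b}"
    and x: "x = orig \<and> P1 \<or> x = p \<and> P2 \<or> x = q \<and> P3 \<or> x = s \<and> P4 \<or> x = a \<and> P5 \<or> x = b \<and> P6"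
    and st: "corner_state n T1 = (x1, y1, z1)" "corner_state n T2 = (x2, y2, z2)"
      "corner_state n T3 = (x3, y3, z3)"
    and P: "x1 \<Longrightarrow> P1 \<longleftrightarrow> P2" "y1 \<Longrightarrow> P1 \<longleftrightarrow> P3" "z1 \<Longrightarrow> P2 \<longleftrightarrow> P3"
      "x2 \<Longrightarrow> P2 \<longleftrightarrow> P5" "y2 \<Longrightarrow> P2 \<longleftrightarrow> P4" "z2 \<Longrightarrow> P5 \<longleftrightarrow> P4"
      "x3 \<Longrightarrow> P3 \<longleftrightarrow> P4" "y3 \<Longrightarrow> P3 \<longleftrightarrow> P6" "z3 \<Longrightarrow> P4 \<longleftrightarrow> P6"
  shows "v = orig \<and> P1 \<or> v = p \<and> P2 \<or> v = q \<and> P3 \<or> v = s \<and> P4 \<or> v = a \<and> P5 \<or> v = b \<and> P6"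
proof -
  let ?S = "{v. v = orig \<and> P1 \<or> v = p \<and> P2 \<or> v = q \<and> P3 \<or> v = s \<and> P4 \<or> v = a \<and> P5 \<or> v = b \<and> P6}"
  have D: "distinct [orig, p, q, s, a, b]" "distinct [b, a, s, q, p, orig]"
    using distinct_corners by auto
  have m: "orig \<in> ?S \<longleftrightarrow> P1" "p \<in> ?S \<longleftrightarrow> P2" "q \<in> ?S \<longleftrightarrow> P3" "s \<in> ?S \<longleftrightarrow> P4" "a \<in> ?S \<longleftrightarrow> P5" "b \<in> ?S \<longleftrightarrow> P6"
    using D by simp_all
  have st': "(orig, p) \<in> reach T1 \<longleftrightarrow> x1" "(orig, q) \<in> reach T1 \<longleftrightarrow> y1" "(p, q) \<in> reach T1 \<longleftrightarrow> z1"
    "(orig, p) \<in> reach T2 \<longleftrightarrow> x2" "(orig, q) \<in> reach T2 \<longleftrightarrow> y2" "(p, q) \<in> reach T2 \<longleftrightarrow> z2"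
    "(orig, p) \<in> reach T3 \<longleftrightarrow> x3" "(orig, q) \<in> reach T3 \<longleftrightarrow> y3" "(p, q) \<in> reach T3 \<longleftrightarrow> z3"
    using st unfolding corner_state_def prod.inject by blast+
  have "v \<in> ?S"
  proof (rule reach_closed_corners[OF assms(1,2) v])
    show "x \<in> ?S" using x by (rule CollectI)
  qed (unfold m st', (rule P; assumption)+)
  then show ?thesis by (rule CollectD)
qed

text \<open>For each outmost vertex the six formulas describe its class among the corners;
  \<open>True\<close> marks the vertex itself. Routes with two links in the same copy are left out,
  since transitivity within that copy replaces them by its third link. This is why \<open>eq\<close>
  is needed to show that the class is closed.\<close>

lemma reach_from_outer:
  assumes st: "corner_state n T1 = (x1, y1, z1)" "corner_state n T2 = (x2, y2, z2)"
      "corner_state n T3 = (x3, y3, z3)"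
    and v: "v \<in> {orig, p, q, s, a, b}"
  shows "(orig, v) \<in> reach T \<Longrightarrow> v = orig \<and> True \<or> v = p \<and> (x1 \<or> y1 \<and> x3 \<and> y2) \<or> v = q \<and> (y1 \<or> x1 \<and> y2 \<and> x3) \<or> v = s \<and> (x1 \<and> y2 \<or> y1 \<and> x3) \<or> v = a \<and> (x1 \<and> x2 \<or> y1 \<and> x3 \<and> z2) \<or> v = b \<and> (y1 \<and> y3 \<or> x1 \<and> y2 \<and> z3)"
    and "(a, v) \<in> reach T \<Longrightarrow> v = orig \<and> (x1 \<and> x2 \<or> y1 \<and> x3 \<and> z2) \<or> v = p \<and> (x2 \<or> z2 \<and> x3 \<and> z1) \<or> v = q \<and> (x2 \<and> z1 \<or> z2 \<and> x3) \<or> v = s \<and> (z2 \<or> x2 \<and> z1 \<and> x3) \<or> v = a \<and> True \<or> v = b \<and> (z2 \<and> z3 \<or> x2 \<and> z1 \<and> y3)"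
    and "(b, v) \<in> reach T \<Longrightarrow> v = orig \<and> (y1 \<and> y3 \<or> x1 \<and> y2 \<and> z3) \<or> v = p \<and> (y3 \<and> z1 \<or> z3 \<and> y2) \<or> v = q \<and> (y3 \<or> z3 \<and> y2 \<and> z1) \<or> v = s \<and> (z3 \<or> y3 \<and> z1 \<and> y2) \<or> v = a \<and> (z2 \<and> z3 \<or> x2 \<and> z1 \<and> y3) \<or> v = b \<and> True"
proof -
  have eq: "is_equiv (x1, y1, z1)" "is_equiv (x2, y2, z2)" "is_equiv (x3, y3, z3)"
    using is_equiv_corner_state st by metis+
  show "v = orig \<and> True \<or> v = p \<and> (x1 \<or> y1 \<and> x3 \<and> y2) \<or> v = q \<and> (y1 \<or> x1 \<and> y2 \<and> x3) \<or> v = s \<and> (x1 \<and> y2 \<or> y1 \<and> x3) \<or> v = a \<and> (x1 \<and> x2 \<or> y1 \<and> x3 \<and> z2) \<or> v = b \<and> (y1 \<and> y3 \<or> x1 \<and> y2 \<and> z3)" if "(orig, v) \<in> reach T"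
    by (rule reach_closed_corners_bool[OF that _ v _ st])
      (simp, simp, (use eq[unfolded is_equiv.simps] in argo)+)
  show "v = orig \<and> (x1 \<and> x2 \<or> y1 \<and> x3 \<and> z2) \<or> v = p \<and> (x2 \<or> z2 \<and> x3 \<and> z1) \<or> v = q \<and> (x2 \<and> z1 \<or> z2 \<and> x3) \<or> v = s \<and> (z2 \<or> x2 \<and> z1 \<and> x3) \<or> v = a \<and> True \<or> v = b \<and> (z2 \<and> z3 \<or> x2 \<and> z1 \<and> y3)" if "(a, v) \<in> reach T"
    by (rule reach_closed_corners_bool[OF that _ v _ st])
      (simp, simp, (use eq[unfolded is_equiv.simps] in argo)+)
  show "v = orig \<and> (y1 \<and> y3 \<or> x1 \<and> y2 \<and> z3) \<or> v = p \<and> (y3 \<and> z1 \<or> z3 \<and> y2) \<or> v = q \<and> (y3 \<or> z3 \<and> y2 \<and> z1) \<or> v = s \<and> (z3 \<or> y3 \<and> z1 \<and> y2) \<or> v = a \<and> (z2 \<and> z3 \<or> x2 \<and> z1 \<and> y3) \<or> v = b \<and> True" if "(b, v) \<in> reach T"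
    by (rule reach_closed_corners_bool[OF that _ v _ st])
      (simp, simp, (use eq[unfolded is_equiv.simps] in argo)+)
qed

text \<open>\<open>reach_from_outer\<close> excludes all further connections; the listed routes are
  composed from the links inside the copies.\<close>

lemma corner_state_merge:
  "corner_state (Suc n) T = glue (corner_state n T1) (corner_state n T2) (corner_state n T3)"
proof -
  obtain x1 y1 z1 x2 y2 z2 x3 y3 z3 where st: "corner_state n T1 = (x1, y1, z1)"
      "corner_state n T2 = (x2, y2, z2)" "corner_state n T3 = (x3, y3, z3)"
    by (metis prod.collapse)
  have link: "x1 \<Longrightarrow> (orig, p) \<in> reach T" "y1 \<Longrightarrow> (orig, q) \<in> reach T" "z1 \<Longrightarrow> (p, q) \<in> reach T"
    "x2 \<Longrightarrow> (p, a) \<in> reach T" "y2 \<Longrightarrow> (p, s) \<in> reach T" "z2 \<Longrightarrow> (a, s) \<in> reach T"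
    "x3 \<Longrightarrow> (q, s) \<in> reach T" "y3 \<Longrightarrow> (q, b) \<in> reach T" "z3 \<Longrightarrow> (s, b) \<in> reach T"
    using st reach_pieces unfolding corner_state_def by simp_all
  have D: "orig \<noteq> a" "orig \<noteq> b" "a \<noteq> orig" "a \<noteq> b" "b \<noteq> orig" "b \<noteq> a"
      "p \<noteq> a" "q \<noteq> a" "s \<noteq> a" "p \<noteq> b" "q \<noteq> b" "s \<noteq> b"
      "a \<noteq> p" "a \<noteq> q" "a \<noteq> s" "b \<noteq> p" "b \<noteq> q" "b \<noteq> s"
    using distinct_corners by auto
  have "(orig, a) \<in> reach T \<longleftrightarrow> x1 \<and> x2 \<or> y1 \<and> x3 \<and> z2"
  proof
    assume "(orig, a) \<in> reach T"
    from reach_from_outer(1)[OF st _ this] D show "x1 \<and> x2 \<or> y1 \<and> x3 \<and> z2" by simp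
  next
    assume "x1 \<and> x2 \<or> y1 \<and> x3 \<and> z2"
    then show "(orig, a) \<in> reach T"
      using link reach_trans[of orig p T a] reach_trans[of orig q T s] reach_trans[of orig s T a]
        reach_sym[of a s T] by blast
  qed
  moreover have "(orig, b) \<in> reach T \<longleftrightarrow> y1 \<and> y3 \<or> x1 \<and> y2 \<and> z3"
  proof
    assume "(orig, b) \<in> reach T"
    from reach_from_outer(1)[OF st _ this] D show "y1 \<and> y3 \<or> x1 \<and> y2 \<and> z3" by simp
  next
    assume "y1 \<and> y3 \<or> x1 \<and> y2 \<and> z3"
    then show "(orig, b) \<in> reach T"
      using link reach_trans[of orig q T b] reach_trans[of orig p T s] reach_trans[of orig s T b]
      by blast
  qed
  moreover have "(a, b) \<in> reach T \<longleftrightarrow> z2 \<and> z3 \<or> x2 \<and> z1 \<and> y3"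
  proof
    assume "(a, b) \<in> reach T"
    from reach_from_outer(2)[OF st _ this] D show "z2 \<and> z3 \<or> x2 \<and> z1 \<and> y3" by simp
  next
    assume "z2 \<and> z3 \<or> x2 \<and> z1 \<and> y3"
    then show "(a, b) \<in> reach T"
      using link reach_trans[of a s T b] reach_trans[of a p T q] reach_trans[of a q T b]
        reach_sym[of p a T] by blast
  qed
  ultimately show ?thesis unfolding st glue.simps by (simp add: corner_state_def)
qed

text \<open>A walk from a vertex of a copy to an outmost vertex meets a corner of that copy.
  Conversely, a vertex that reaches a corner of its copy goes on to an outmost vertex, because
  \<open>rooted\<close> says this of the three glued vertices.\<close>

lemma covers_merge:
  "covers (Suc n) T \<longleftrightarrow> covers n T1 \<and> covers n T2 \<and> covers n T3 \<and>
     rooted (corner_state n T1) (corner_state n T2) (corner_state n T3)"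
proof -
  obtain x1 y1 z1 x2 y2 z2 x3 y3 z3 where st: "corner_state n T1 = (x1, y1, z1)"
      "corner_state n T2 = (x2, y2, z2)" "corner_state n T3 = (x3, y3, z3)"
    by (metis prod.collapse)
  have link: "x1 \<Longrightarrow> (orig, p) \<in> reach T" "y1 \<Longrightarrow> (orig, q) \<in> reach T" "z1 \<Longrightarrow> (p, q) \<in> reach T"
    "x2 \<Longrightarrow> (p, a) \<in> reach T" "y2 \<Longrightarrow> (p, s) \<in> reach T" "z2 \<Longrightarrow> (a, s) \<in> reach T"
    "x3 \<Longrightarrow> (q, s) \<in> reach T" "y3 \<Longrightarrow> (q, b) \<in> reach T" "z3 \<Longrightarrow> (s, b) \<in> reach T"
    using st reach_pieces unfolding corner_state_def by simp_all
  have D: "p \<noteq> orig" "p \<noteq> q" "p \<noteq> s" "p \<noteq> a" "p \<noteq> b" "q \<noteq> orig" "q \<noteq> p" "q \<noteq> s" "q \<noteq> a" "q \<noteq> b"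
    "s \<noteq> orig" "s \<noteq> p" "s \<noteq> q" "s \<noteq> a" "s \<noteq> b"
    using distinct_corners by auto
  define out where "out v \<longleftrightarrow> (v, orig) \<in> reach T \<or> (v, a) \<in> reach T \<or> (v, b) \<in> reach T" for v
  have out_trans: "out u" if "(u, v) \<in> reach T" "out v" for u v
    using that reach_trans[of u v T] unfolding out_def by blast
  have out_p: "out p \<longleftrightarrow> x1 \<or> x2 \<or> z1 \<and> y3 \<or> z1 \<and> x3 \<and> z2 \<or> y2 \<and> z3 \<or> y2 \<and> x3 \<and> y1"
    and out_q: "out q \<longleftrightarrow> y1 \<or> y3 \<or> z1 \<and> x2 \<or> z1 \<and> y2 \<and> z3 \<or> x3 \<and> z2 \<or> x3 \<and> y2 \<and> x1"
    and out_s: "out s \<longleftrightarrow> z2 \<or> z3 \<or> y2 \<and> x1 \<or> y2 \<and> z1 \<and> y3 \<or> x3 \<and> y1 \<or> x3 \<and> z1 \<and> x2"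
  proof -
    have l: "x1 \<Longrightarrow> out p" "y1 \<Longrightarrow> out q" "x2 \<Longrightarrow> out p" "z2 \<Longrightarrow> out s" "y3 \<Longrightarrow> out q" "z3 \<Longrightarrow> out s"
      using link reach_sym[of orig p T] reach_sym[of orig q T] reach_sym[of a s T]
      unfolding out_def by blast+
    have l': "z1 \<Longrightarrow> out p \<longleftrightarrow> out q" "y2 \<Longrightarrow> out p \<longleftrightarrow> out s" "x3 \<Longrightarrow> out q \<longleftrightarrow> out s"
      using link(3,5,7) reach_sym[of p q T] reach_sym[of p s T] reach_sym[of q s T]
        out_trans[of p q] out_trans[of q p] out_trans[of p s] out_trans[of s p] out_trans[of q s]
        out_trans[of s q] by blast+
    have out_sym: "out v \<longleftrightarrow> (orig, v) \<in> reach T \<or> (a, v) \<in> reach T \<or> (b, v) \<in> reach T" for v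
      unfolding out_def using reach_sym[of v _ T] reach_sym[of _ v T] by blast
    show "out p \<longleftrightarrow> x1 \<or> x2 \<or> z1 \<and> y3 \<or> z1 \<and> x3 \<and> z2 \<or> y2 \<and> z3 \<or> y2 \<and> x3 \<and> y1" (is "_ \<longleftrightarrow> ?R")
    proof
      assume "out p"
      then show ?R using reach_from_outer[OF st, of p] D unfolding out_sym[of p] by simp blast
    next
      show "out p" if ?R using that l l' by argo
    qed
    show "out q \<longleftrightarrow> y1 \<or> y3 \<or> z1 \<and> x2 \<or> z1 \<and> y2 \<and> z3 \<or> x3 \<and> z2 \<or> x3 \<and> y2 \<and> x1" (is "_ \<longleftrightarrow> ?R")
    proof
      assume "out q"
      then show ?R using reach_from_outer[OF st, of q] D unfolding out_sym[of q] by simp blast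
    next
      show "out q" if ?R using that l l' by argo
    qed
    show "out s \<longleftrightarrow> z2 \<or> z3 \<or> y2 \<and> x1 \<or> y2 \<and> z1 \<and> y3 \<or> x3 \<and> y1 \<or> x3 \<and> z1 \<and> x2" (is "_ \<longleftrightarrow> ?R")
    proof
      assume "out s"
      then show ?R using reach_from_outer[OF st, of s] D unfolding out_sym[of s] by simp blast
    next
      show "out s" if ?R using that l l' by argo
    qed
  qed
  have rooted: "rooted (corner_state n T1) (corner_state n T2) (corner_state n T3) \<longleftrightarrow> out p \<and> out q \<and> out s"
    unfolding st rooted.simps out_p out_q out_s by (rule refl)
  have covers_out: "covers (Suc n) T \<longleftrightarrow> (\<forall>v\<in>sg_verts (Suc n). out v)"
    unfolding covers_def sg_corner_set_def out_def by simp
  have out_outer: "out orig" "out a" "out b" unfolding out_def using reach_refl by simp_all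
  show ?thesis
  proof
    assume cov: "covers (Suc n) T"
    have piece: "\<exists>c\<in>{d, d + p, d + q}. (d + v, c) \<in> reach (piece d)"
      if d: "d \<in> sg_corner_set n" and v: "v \<in> sg_verts n" for d v
    proof -
      have "d + v \<in> sg_verts (Suc n)"
        using d v by (auto simp: sg_corner_set_def sg_left_eq_0)
      then have "out (d + v)" using cov covers_out by blast
      \<comment> \<open>Each outmost vertex is a corner of one of the copies, as
        \<open>reach_piece_corner\<close> demands of the end of the walk.\<close>
      moreover have "orig \<in> {orig, orig + p, orig + q}" "a \<in> {p, p + p, p + q}" "b \<in> {q, q + p, q + q}"
        by (simp_all add: sg_Suc)
      ultimately obtain j c where "j \<in> sg_corner_set n" "c \<in> {j, j + p, j + q}" "(d + v, c) \<in> reach T"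
        unfolding out_def sg_corner_set_def by blast
      then show ?thesis
        using reach_piece_corner[OF d imageI[OF v]] unfolding pieces_Union by blast
    qed
    have "covers n X" if d: "d \<in> sg_corner_set n" and X: "piece d = shift d X" for d X
      unfolding covers_def
    proof
      fix v assume "v \<in> sg_verts n"
      then obtain c where "c \<in> {d, d + p, d + q}" "(d + v, c) \<in> reach (shift d X)"
        using piece[OF d] unfolding X by blast
      moreover have "d + orig = d" by (simp add: sg_left_eq_0)
      ultimately show "\<exists>c\<in>sg_corner_set n. (v, c) \<in> reach X"
        using reach_shift[of d v orig X] reach_shift[of d v p X] reach_shift[of d v q X]
        unfolding sg_corner_set_def by auto
    qed
    moreover have "orig \<in> sg_corner_set n" "p \<in> sg_corner_set n" "q \<in> sg_corner_set n"
      by (simp_all add: sg_corner_set_def)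
    moreover have "piece orig = shift orig T1" by (simp add: piece_def)
    ultimately have "covers n T1" "covers n T2" "covers n T3"
      using pieces(2,3) by blast+
    moreover have "out p \<and> out q \<and> out s"
    proof -
      have "p \<in> sg_verts (Suc n)" "q \<in> sg_verts (Suc n)" "s \<in> sg_verts (Suc n)"
        using sg_corners[of n] by auto
      then show ?thesis using cov covers_out by blast
    qed
    ultimately show "covers n T1 \<and> covers n T2 \<and> covers n T3 \<and>
        rooted (corner_state n T1) (corner_state n T2) (corner_state n T3)"
      unfolding rooted by blast
  next
    assume R: "covers n T1 \<and> covers n T2 \<and> covers n T3 \<and>
        rooted (corner_state n T1) (corner_state n T2) (corner_state n T3)"
    then have o3: "out p" "out q" "out s" unfolding rooted by blast+
    have "out v" if "v \<in> sg_verts (Suc n)" for v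
    proof -
      from that consider (1) "v \<in> sg_verts n" | (2) u where "v = p + u" "u \<in> sg_verts n"
        | (3) u where "v = q + u" "u \<in> sg_verts n" by auto
      then show ?thesis
      proof cases
        case 1
        then obtain c where "c \<in> {orig, p, q}" "(v, c) \<in> reach T1"
          using R unfolding covers_def sg_corner_set_def by blast
        then show ?thesis using reach_merge(1)[of v c] out_trans[of v c] o3 out_outer by blast
      next
        case 2
        then obtain c where "c \<in> {orig, p, q}" "(u, c) \<in> reach T2"
          using R unfolding covers_def sg_corner_set_def by blast
        moreover have "p + orig = p" "p + p = a" "p + q = s" by (simp_all add: sg_Suc sg_left_eq_0)
        ultimately have "out (p + c)" "(v, p + c) \<in> reach T"
          using reach_merge(2)[of u c] 2 o3 out_outer by auto
        then show ?thesis using out_trans by blast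
      next
        case 3
        then obtain c where "c \<in> {orig, p, q}" "(u, c) \<in> reach T3"
          using R unfolding covers_def sg_corner_set_def by blast
        moreover have "q + orig = q" "q + p = s" "q + q = b"
          by (simp_all add: sg_Suc sg_left_eq_0 add.commute)
        ultimately have "out (q + c)" "(v, q + c) \<in> reach T"
          using reach_merge(3)[of u c] 3 o3 out_outer by auto
        then show ?thesis using out_trans by blast
      qed
    qed
    then show "covers (Suc n) T" unfolding covers_out by blast
  qed
qed

end

section \<open>Counting\<close>

text \<open>By \<open>card_le_edges_plus_blocks\<close> the last equation says that \<open>T\<close> has as few edges as possible,
  that is, no cycle.\<close>

definition forests :: "nat \<Rightarrow> state \<Rightarrow> vertex set set set" where
  "forests n \<pi> = {T. T \<subseteq> sg_edges n \<and> covers n T \<and> corner_state n T = \<pi> \<and>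
     card T + blocks \<pi> = card (sg_verts n)}"

lemma sg_trees_eq_forests: "sg_trees n = forests n (True, True, True)"
proof -
  have "(\<forall>v\<in>sg_verts n. (sg_left, v) \<in> reach T) \<longleftrightarrow>
      covers n T \<and> corner_state n T = (True, True, True)" for T
  proof
    assume "\<forall>v\<in>sg_verts n. (sg_left, v) \<in> reach T"
    then have *: "(sg_left, v) \<in> reach T" if "v \<in> sg_verts n" for v using that by blast
    have "covers n T" unfolding covers_def sg_corner_set_def using reach_sym[OF *] by blast
    moreover have "(sg_right n, sg_top n) \<in> reach T"
      using reach_trans[OF reach_sym[OF *[OF sg_corners(2)]] *[OF sg_corners(3)]] .
    ultimately show "covers n T \<and> corner_state n T = (True, True, True)"
      using *[OF sg_corners(2)] *[OF sg_corners(3)] by (simp add: corner_state_def)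
  next
    assume c: "covers n T \<and> corner_state n T = (True, True, True)"
    show "\<forall>v\<in>sg_verts n. (sg_left, v) \<in> reach T"
    proof
      fix v assume "v \<in> sg_verts n"
      then obtain d where "d \<in> sg_corner_set n" "(v, d) \<in> reach T"
        using c unfolding covers_def by blast
      then show "(sg_left, v) \<in> reach T"
        using c reach_refl[of sg_left T] reach_sym[of v d T] reach_trans[of sg_left d T v]
        by (auto simp: corner_state_def sg_corner_set_def)
    qed
  qed
  then show ?thesis
    unfolding sg_trees_def forests_def
    by (auto simp: spanning_trees_iff[OF simple_graph_sg sg_corners(1)])
qed

lemma sg_two_trees_eq_forests: "sg_two_trees n = forests n (True, False, False)"
proof -
  have "(\<forall>v\<in>sg_verts n. (sg_top n, v) \<in> reach T \<or> (sg_left, v) \<in> reach T) \<and>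
      (sg_top n, sg_left) \<notin> reach T \<and> (sg_left, sg_right n) \<in> reach T \<longleftrightarrow>
      covers n T \<and> corner_state n T = (True, False, False)" (is "?L \<longleftrightarrow> ?R") for T
  proof
    assume L: ?L
    then have "covers n T" unfolding covers_def sg_corner_set_def using reach_sym[of _ _ T] by blast
    moreover have "(sg_left, sg_top n) \<notin> reach T" "(sg_right n, sg_top n) \<notin> reach T"
      using L reach_sym[of sg_left "sg_top n" T] reach_trans[of sg_left "sg_right n" T "sg_top n"]
      by blast+
    ultimately show ?R using L by (simp add: corner_state_def)
  next
    assume R: ?R
    then have s: "(sg_left, sg_right n) \<in> reach T" "(sg_left, sg_top n) \<notin> reach T"
      by (simp_all add: corner_state_def)
    have "(sg_top n, v) \<in> reach T \<or> (sg_left, v) \<in> reach T" if "v \<in> sg_verts n" for v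
    proof -
      from R[THEN conjunct1, unfolded covers_def sg_corner_set_def, rule_format, OF that]
      obtain d where d: "d \<in> {sg_left, sg_right n, sg_top n}" "(v, d) \<in> reach T" by (rule bexE)
      from d(1) reach_sym[OF d(2)]
      have "(sg_left, v) \<in> reach T \<or> (sg_right n, v) \<in> reach T \<or> (sg_top n, v) \<in> reach T" by blast
      then show ?thesis using s(1) reach_trans[of sg_left "sg_right n" T v] by blast
    qed
    then show ?L using s reach_sym[of "sg_top n" sg_left T] by blast
  qed
  note eq = this
  have P: "{sg_top n} \<subseteq> sg_verts n" "{sg_left, sg_right n} \<subseteq> sg_verts n"
    "sg_top n \<in> {sg_top n}" "sg_left \<in> {sg_left, sg_right n}"
    using sg_corners[of n] by auto
  have "T \<in> sg_two_trees n \<longleftrightarrow> T \<in> forests n (True, False, False)" for T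
    using eq[of T] unfolding sg_two_trees_def forests_def spanning_two_trees_iff[OF simple_graph_sg P]
    by (auto simp: reach_refl)
  then show ?thesis by blast
qed

text \<open>The nine corners of the copies become six vertices. The three partitions contribute 9
  minus the sum of their block numbers as links, and at least \<open>6 - blocks \<pi>\<close> links
  are needed to leave only \<open>blocks \<pi>\<close> classes. The last equation says that this
  minimum is attained, so the gluing creates no cycle.\<close>

definition compatible :: "state \<Rightarrow> state \<Rightarrow> state \<Rightarrow> state \<Rightarrow> bool" where
  "compatible \<pi> s1 s2 s3 \<longleftrightarrow> rooted s1 s2 s3 \<and> glue s1 s2 s3 = \<pi> \<and>
     blocks s1 + blocks s2 + blocks s3 = 3 + blocks \<pi>"

lemma forests_merge:
  assumes "T1 \<subseteq> sg_edges n" "T2 \<subseteq> sg_edges n" "T3 \<subseteq> sg_edges n"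
  shows "merge n T1 T2 T3 \<in> forests (Suc n) \<pi> \<longleftrightarrow>
    (\<exists>s1 s2 s3. compatible \<pi> s1 s2 s3 \<and> T1 \<in> forests n s1 \<and> T2 \<in> forests n s2 \<and> T3 \<in> forests n s3)"
    (is "?L \<longleftrightarrow> ?R")
proof -
  interpret sg_merge n T1 T2 T3 by unfold_locales (use assms in auto)
  have subT: "T \<subseteq> sg_edges (Suc n)"
    using assms unfolding sg_edges_Suc_merge merge_def by blast
  let ?s1 = "corner_state n T1" and ?s2 = "corner_state n T2" and ?s3 = "corner_state n T3"
  show ?thesis
  proof
    assume ?L
    then have cov: "covers n T1" "covers n T2" "covers n T3" and r: "rooted ?s1 ?s2 ?s3"
      and glue: "glue ?s1 ?s2 ?s3 = \<pi>"
      and card: "card T1 + card T2 + card T3 + blocks \<pi> = card (sg_verts (Suc n))"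
      unfolding forests_def mem_Collect_eq covers_merge corner_state_merge card_merge by blast+
    have "blocks ?s1 + blocks ?s2 + blocks ?s3 \<le> 3 + blocks \<pi>"
      using blocks_glue[OF is_equiv_corner_state is_equiv_corner_state is_equiv_corner_state r] glue
      by simp
    moreover have "card (sg_verts n) \<le> card T1 + blocks ?s1" "card (sg_verts n) \<le> card T2 + blocks ?s2"
      "card (sg_verts n) \<le> card T3 + blocks ?s3"
      using card_le_edges_plus_blocks assms cov by blast+
    moreover note card card_sg_verts_Suc[of n]
    \<comment> \<open>With N the number of vertices of \<open>SG(n)\<close>, the lower bounds give
      at least 3N for the sum of all edges and blocks, while the rank inequality and the global
      count give at most 3N. Hence everything is sharp.\<close>
    ultimately have "blocks ?s1 + blocks ?s2 + blocks ?s3 = 3 + blocks \<pi>"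
      "card T1 + blocks ?s1 = card (sg_verts n)" "card T2 + blocks ?s2 = card (sg_verts n)"
      "card T3 + blocks ?s3 = card (sg_verts n)" by linarith+
    then show ?R using cov r glue assms unfolding forests_def compatible_def by blast
  next
    assume ?R
    then have cov: "covers n T1" "covers n T2" "covers n T3"
      and comp: "compatible \<pi> ?s1 ?s2 ?s3"
      and card: "card T1 + blocks ?s1 = card (sg_verts n)" "card T2 + blocks ?s2 = card (sg_verts n)"
        "card T3 + blocks ?s3 = card (sg_verts n)"
      unfolding forests_def by auto
    then show ?L
      using card_sg_verts_Suc[of n] subT
      unfolding forests_def mem_Collect_eq covers_merge corner_state_merge card_merge compatible_def
      by auto
  qed
qed

section \<open>Counting triples by their corner partitions\<close>

definition states :: "state set" where
  "states = {(True, True, True), (True, False, False), (False, True, False), (False, False, True),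
     (False, False, False)}"

lemma forests_empty: "s \<notin> states \<Longrightarrow> forests n s = {}"
proof -
  have "s \<in> states" if "T \<in> forests n s" for T
  proof -
    have "s = corner_state n T" using that by (simp add: forests_def)
    then have "is_equiv s" using is_equiv_corner_state by simp
    then show ?thesis by (cases rule: is_equiv_cases) (simp_all add: states_def)
  qed
  then show "s \<notin> states \<Longrightarrow> forests n s = {}" by blast
qed

lemma finite_forests: "finite (forests n s)"
  by (rule finite_subset[of _ "Pow (sg_edges n)"])
    (auto simp: forests_def finite_edges[OF simple_graph_sg])

text \<open>The edge sets of the copies are disjoint, so intersecting with them recovers the pieces,
  and translations are injective.\<close>

lemma merge_inj:
  "inj_on (\<lambda>(T1, T2, T3). merge n T1 T2 T3) (Pow (sg_edges n) \<times> Pow (sg_edges n) \<times> Pow (sg_edges n))"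
proof -
  let ?E = "sg_edges n" and ?p = "sg_right n" and ?q = "sg_top n"
  have rec: "merge n T1 T2 T3 \<inter> ?E = T1 \<and> merge n T1 T2 T3 \<inter> shift ?p ?E = shift ?p T2 \<and>
      merge n T1 T2 T3 \<inter> shift ?q ?E = shift ?q T3"
    if "T1 \<subseteq> ?E" "T2 \<subseteq> ?E" "T3 \<subseteq> ?E" for T1 T2 T3
  proof -
    have "X \<union> Y \<union> Z = W \<Longrightarrow> W \<inter> A = X \<and> W \<inter> B = Y \<and> W \<inter> C = Z"
      if "X \<subseteq> A" "Y \<subseteq> B" "Z \<subseteq> C" "A \<inter> B = {}" "A \<inter> C = {}" "B \<inter> C = {}"
      for X Y Z W A B C :: "vertex set set"
      using that by blast
    from this[OF that(1) image_mono[OF that(2)] image_mono[OF that(3)] sg_edges_disjoint]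
    show ?thesis by (simp add: merge_def)
  qed
  have inj: "T = T'" if "shift d T = shift d T'" for d T T'
  proof -
    have "inj ((`) ((+) d))" by (simp add: inj_def inj_image_eq_iff[OF inj_add_vertex])
    with that show ?thesis by (simp add: inj_image_eq_iff)
  qed
  show ?thesis
  proof (rule inj_onI)
    fix x y
    assume xy: "x \<in> Pow ?E \<times> Pow ?E \<times> Pow ?E" "y \<in> Pow ?E \<times> Pow ?E \<times> Pow ?E"
      "(case x of (T1, T2, T3) \<Rightarrow> merge n T1 T2 T3) = (case y of (T1, T2, T3) \<Rightarrow> merge n T1 T2 T3)"
    obtain T1 T2 T3 T1' T2' T3' where eq: "x = (T1, T2, T3)" "y = (T1', T2', T3')"
      by (metis prod.collapse)
    with xy have sub: "T1 \<subseteq> ?E" "T2 \<subseteq> ?E" "T3 \<subseteq> ?E" "T1' \<subseteq> ?E" "T2' \<subseteq> ?E" "T3' \<subseteq> ?E"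
      and m: "merge n T1 T2 T3 = merge n T1' T2' T3'" by simp_all
    have "T1 = T1'" "shift ?p T2 = shift ?p T2'" "shift ?q T3 = shift ?q T3'"
      using rec[OF sub(1-3)] rec[OF sub(4-6)] unfolding m by metis+
    then show "x = y" using inj[of ?p T2 T2'] inj[of ?q T3 T3'] unfolding eq by blast
  qed
qed

lemma merge_surj:
  assumes "T \<subseteq> sg_edges (Suc n)"
  obtains T1 T2 T3 where "T1 \<subseteq> sg_edges n" "T2 \<subseteq> sg_edges n" "T3 \<subseteq> sg_edges n" "T = merge n T1 T2 T3"
proof
  let ?S = "\<lambda>d. {e \<in> sg_edges n. (+) d ` e \<in> T}"
  show "T = merge n (T \<inter> sg_edges n) (?S (sg_right n)) (?S (sg_top n))"
    using assms unfolding sg_edges_Suc_merge merge_def by blast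
qed auto

text \<open>The property \<open>P\<close> is assumed to depend on the lower-left piece only. The
  trivial property gives the plain counts, and a prescribed degree at \<open>o\<close> the refined
  ones.\<close>

lemma card_forests_Suc:
  assumes Q: "\<And>T1 T2 T3. T1 \<subseteq> sg_edges n \<Longrightarrow> T2 \<subseteq> sg_edges n \<Longrightarrow> T3 \<subseteq> sg_edges n \<Longrightarrow>
    P (merge n T1 T2 T3) \<longleftrightarrow> Q T1"
  shows "card {T \<in> forests (Suc n) \<pi>. P T} =
    (\<Sum>s1\<in>states. \<Sum>s2\<in>states. \<Sum>s3\<in>states. if compatible \<pi> s1 s2 s3
      then card {T \<in> forests n s1. Q T} * card (forests n s2) * card (forests n s3) else 0)"
proof -
  let ?E = "Pow (sg_edges n)"
  let ?m = "\<lambda>(T1, T2, T3). merge n T1 T2 T3"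
  let ?B = "\<lambda>(s1, s2, s3). {T \<in> forests n s1. Q T} \<times> forests n s2 \<times> forests n s3"
  let ?I = "{(s1, s2, s3) \<in> states \<times> states \<times> states. compatible \<pi> s1 s2 s3}"
  have fin3: "finite (states \<times> states \<times> states)"
    by (simp add: states_def)
  have finI: "finite ?I"
    by (rule finite_subset[OF _ fin3]) blast
  have BE: "?B i \<subseteq> ?E \<times> ?E \<times> ?E" for i
    by (cases i) (auto simp: forests_def)
  have "{T \<in> forests (Suc n) \<pi>. P T} = ?m ` (\<Union>i\<in>?I. ?B i)"
  proof (intro equalityI subsetI)
    fix T assume T: "T \<in> {T \<in> forests (Suc n) \<pi>. P T}"
    then have "T \<subseteq> sg_edges (Suc n)" by (simp add: forests_def)
    then obtain T1 T2 T3 where m: "T1 \<subseteq> sg_edges n" "T2 \<subseteq> sg_edges n" "T3 \<subseteq> sg_edges n"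
      "T = merge n T1 T2 T3" by (rule merge_surj)
    then obtain s1 s2 s3 where s: "compatible \<pi> s1 s2 s3" "T1 \<in> forests n s1" "T2 \<in> forests n s2"
        "T3 \<in> forests n s3"
      using T forests_merge[OF m(1-3), of \<pi>] by blast
    moreover have "s1 \<in> states" "s2 \<in> states" "s3 \<in> states" using s(2-4) forests_empty[of _ n] by (metis empty_iff)+
    moreover have "Q T1" using T Q[OF m(1-3)] m(4) by simp
    ultimately have "(T1, T2, T3) \<in> (\<Union>i\<in>?I. ?B i)" by (intro UN_I[of "(s1, s2, s3)"]) simp_all
    then show "T \<in> ?m ` (\<Union>i\<in>?I. ?B i)" unfolding m(4) by (rule rev_image_eqI) simp
  next
    fix T assume "T \<in> ?m ` (\<Union>i\<in>?I. ?B i)"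
    then obtain T1 T2 T3 s1 s2 s3 where T: "T = merge n T1 T2 T3" "compatible \<pi> s1 s2 s3"
      "T1 \<in> forests n s1" "Q T1" "T2 \<in> forests n s2" "T3 \<in> forests n s3" by auto
    then have sub: "T1 \<subseteq> sg_edges n" "T2 \<subseteq> sg_edges n" "T3 \<subseteq> sg_edges n"
      by (simp_all add: forests_def)
    then show "T \<in> {T \<in> forests (Suc n) \<pi>. P T}"
      using forests_merge[OF sub, of \<pi>] Q[OF sub] T by blast
  qed
  moreover have "inj_on ?m (\<Union>i\<in>?I. ?B i)"
    by (rule inj_on_subset[OF merge_inj]) (use BE in blast)
  ultimately have "card {T \<in> forests (Suc n) \<pi>. P T} = card (\<Union>i\<in>?I. ?B i)"
    by (simp add: card_image)
  also have "\<dots> = (\<Sum>i\<in>?I. card (?B i))"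
  proof (rule card_UN_disjoint[OF finI])
    show "\<forall>i\<in>?I. finite (?B i)"
      using finite_forests by (simp add: case_prod_beta)
    \<comment> \<open>The index of a triple is determined by its corner states, so the products are
      pairwise disjoint.\<close>
    have st: "i = (corner_state n (fst x), corner_state n (fst (snd x)), corner_state n (snd (snd x)))"
      if "x \<in> ?B i" for i x
      using that by (cases i; cases x) (simp add: forests_def)
    show "\<forall>i\<in>?I. \<forall>j\<in>?I. i \<noteq> j \<longrightarrow> ?B i \<inter> ?B j = {}"
    proof (intro ballI impI equals0I)
      fix i j x assume "i \<noteq> j" and x: "x \<in> ?B i \<inter> ?B j"
      then show False using st[OF IntD1[OF x]] st[OF IntD2[OF x]] by simp
    qed
  qed
  also have "\<dots> = (\<Sum>(s1, s2, s3)\<in>states \<times> states \<times> states. if compatible \<pi> s1 s2 s3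
      then card {T \<in> forests n s1. Q T} * card (forests n s2) * card (forests n s3) else 0)"
    by (rule sum.mono_neutral_cong_left[OF fin3])
      (auto simp: card_cartesian_product mult.assoc split: if_splits)
  finally show ?thesis by (simp add: sum.cartesian_product)
qed

lemma sum_states: "sum h states = h (True, True, True) + h (True, False, False) + h (False, True, False) +
    h (False, False, True) + h (False, False, False)" for h :: "state \<Rightarrow> nat"
  by (simp add: states_def)

text \<open>\<open>u\<close> weights the lower-left copy and \<open>w\<close> the other two.
  \<open>ug\<close>, \<open>ur\<close>, \<open>ul\<close> belong to the states separating the top,
  right and left corner; they are kept apart because a weight depending on the degree at
  \<open>o\<close> is not symmetric. The first three sums lack \<open>ul\<close> and
  \<open>ut\<close>: if \<open>o\<close> is alone among the corners of its copy, it is alone in the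
  merged partition too.\<close>

lemma sum_compatible:
  fixes u w :: "state \<Rightarrow> nat"
  assumes "u (True, True, True) = uf" "u (True, False, False) = ug" "u (False, True, False) = ur"
    "u (False, False, True) = ul" "u (False, False, False) = ut"
    and "w (True, True, True) = f" "w (True, False, False) = g" "w (False, True, False) = g"
    "w (False, False, True) = g" "w (False, False, False) = t"
  defines "S \<equiv> \<lambda>\<pi>. \<Sum>s1\<in>states. \<Sum>s2\<in>states. \<Sum>s3\<in>states. if compatible \<pi> s1 s2 s3 then u s1 * w s2 * w s3 else 0"
  shows
    "S (True, True, True) = 4 * uf * f * g + ug * f * f + ur * f * f"
    "S (True, False, False) = uf * f * t + 3 * uf * g * g + 3 * ug * f * g + ur * f * g"
    "S (False, True, False) = 3 * uf * g * g + uf * f * t + ug * f * g + 3 * ur * f * g"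
    "S (False, False, True) = uf * g * g + ug * f * g + ur * f * g + 4 * ul * f * g + ut * f * f"
    "S (False, False, False) = 4 * uf * g * t + 4 * ug * g * g + ug * f * t + ur * f * t + 4 * ur * g * g + 2 * ul * f * t + 6 * ul * g * g + 4 * ut * f * g"
  unfolding S_def sum_states compatible_def
  by (simp, simp only: assms(1-10), simp add: algebra_simps)+

section \<open>The initial triangle\<close>

lemma corner_state_0:
  fixes T :: "vertex set set"
  assumes "T \<subseteq> sg_edges 0"
  defines "x \<equiv> {sg_left, sg_right 0} \<in> T" and "y \<equiv> {sg_left, sg_top 0} \<in> T"
    and "z \<equiv> {sg_right 0, sg_top 0} \<in> T"
  shows "corner_state 0 T = (x \<or> y \<and> z, y \<or> x \<and> z, z \<or> x \<and> y)"
proof -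
  let ?o = "sg_left" and ?a = "sg_right 0" and ?b = "sg_top 0"
  have ne: "?o \<noteq> ?a" "?o \<noteq> ?b" "?a \<noteq> ?b" "?a \<noteq> ?o" "?b \<noteq> ?o" "?b \<noteq> ?a"
    by (simp_all add: sg_left_def sg_right_def sg_top_def)
  have edge: "{u, v} = {?o, ?a} \<and> x \<or> {u, v} = {?o, ?b} \<and> y \<or> {u, v} = {?a, ?b} \<and> z"
    if uv: "{u, v} \<in> T" for u v
  proof -
    have "{u, v} \<in> {{?o, ?a}, {?o, ?b}, {?a, ?b}}"
      using subsetD[OF assms(1) uv] unfolding sg_edges.simps .
    then show ?thesis using uv unfolding x_def y_def z_def by (metis empty_iff insert_iff)
  qed
  have closed: "v \<in> W"
    if "(u, v) \<in> reach T" "u \<in> W" and W: "x \<Longrightarrow> ?o \<in> W \<longleftrightarrow> ?a \<in> W" "y \<Longrightarrow> ?o \<in> W \<longleftrightarrow> ?b \<in> W"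
      "z \<Longrightarrow> ?a \<in> W \<longleftrightarrow> ?b \<in> W" for u v W
    using that(1,2)
  proof (rule reach_closed)
    fix u' v' assume "u' \<in> W" "{u', v'} \<in> T"
    then show "v' \<in> W" using edge[of u' v'] W unfolding doubleton_eq_iff by metis
  qed
  have e: "x \<Longrightarrow> (?o, ?a) \<in> reach T" "y \<Longrightarrow> (?o, ?b) \<in> reach T" "z \<Longrightarrow> (?a, ?b) \<in> reach T"
    unfolding x_def y_def z_def by (rule reach_edge, assumption)+
  have "(?o, ?a) \<in> reach T \<longleftrightarrow> x \<or> y \<and> z"
  proof
    assume "(?o, ?a) \<in> reach T"
    \<comment> \<open>The set is the component of the starting corner, expressed by the edges
      present.\<close>
    then have "?a \<in> {v. v = ?o \<or> v = ?a \<and> (x \<or> y \<and> z) \<or> v = ?b \<and> (y \<or> x \<and> z)}"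
      by (rule closed) (auto simp: ne)
    then show "x \<or> y \<and> z" using ne by simp
  next
    show "(?o, ?a) \<in> reach T" if "x \<or> y \<and> z"
      using that e reach_sym[of ?a ?b T] reach_trans[of ?o ?b T ?a] by blast
  qed
  moreover have "(?o, ?b) \<in> reach T \<longleftrightarrow> y \<or> x \<and> z"
  proof
    assume "(?o, ?b) \<in> reach T"
    then have "?b \<in> {v. v = ?o \<or> v = ?a \<and> (x \<or> y \<and> z) \<or> v = ?b \<and> (y \<or> x \<and> z)}"
      by (rule closed) (auto simp: ne)
    then show "y \<or> x \<and> z" using ne by simp
  next
    show "(?o, ?b) \<in> reach T" if "y \<or> x \<and> z"
      using that e reach_trans[of ?o ?a T ?b] by blast
  qed
  moreover have "(?a, ?b) \<in> reach T \<longleftrightarrow> z \<or> x \<and> y"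
  proof
    assume "(?a, ?b) \<in> reach T"
    then have "?b \<in> {v. v = ?a \<or> v = ?o \<and> (x \<or> y \<and> z) \<or> v = ?b \<and> (z \<or> x \<and> y)}"
      by (rule closed) (auto simp: ne)
    then show "z \<or> x \<and> y" using ne by simp
  next
    show "(?a, ?b) \<in> reach T" if "z \<or> x \<and> y"
      using that e reach_sym[of ?o ?a T] reach_trans[of ?a ?o T ?b] by blast
  qed
  ultimately show ?thesis by (simp add: corner_state_def)
qed

lemma forests_0:
  defines "c \<equiv> {sg_left, sg_right 0}" and "d \<equiv> {sg_left, sg_top 0}" and "e \<equiv> {sg_right 0, sg_top 0}"
  shows "forests 0 (True, True, True) = {{c, d}, {c, e}, {d, e}}"
    "forests 0 (True, False, False) = {{c}}" "forests 0 (False, True, False) = {{d}}"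
    "forests 0 (False, False, True) = {{e}}" "forests 0 (False, False, False) = {{}}"
    and "c \<noteq> d" "c \<noteq> e" "d \<noteq> e"
    and "sg_left \<in> c" "sg_left \<in> d" "sg_left \<notin> e"
proof -
  have ne: "sg_left \<noteq> sg_right 0" "sg_left \<noteq> sg_top 0" "sg_right 0 \<noteq> sg_top 0"
    by (simp_all add: sg_left_def sg_right_def sg_top_def)
  then show n: "c \<noteq> d" "c \<noteq> e" "d \<noteq> e" and "sg_left \<in> c" "sg_left \<in> d" "sg_left \<notin> e"
    by (auto simp: c_def d_def e_def doubleton_eq_iff)
  have E: "sg_edges 0 = {c, d, e}" by (simp add: c_def d_def e_def)
  have card: "card (sg_verts 0) = 3" using ne by simp
  \<comment> \<open>Every vertex of the triangle is a corner.\<close>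
  have covers: "covers 0 T" for T
    by (auto simp: covers_def sg_corner_set_def reach_refl intro: exI)
  have forests: "forests 0 s = {T \<in> {{}, {c}, {d}, {e}, {c, d}, {c, e}, {d, e}, {c, d, e}}.
      (c \<in> T \<or> d \<in> T \<and> e \<in> T, d \<in> T \<or> c \<in> T \<and> e \<in> T, e \<in> T \<or> c \<in> T \<and> d \<in> T) = s \<and>
      card T + blocks s = 3}" for s
  proof -
    have "{{}, {c}, {d}, {e}, {c, d}, {c, e}, {d, e}, {c, d, e}} = Pow (sg_edges 0)"
      unfolding E Pow_insert Pow_empty by auto
    then have P: "T \<in> {{}, {c}, {d}, {e}, {c, d}, {c, e}, {d, e}, {c, d, e}} \<longleftrightarrow> T \<subseteq> sg_edges 0" for T
      by simp
    show ?thesis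
    proof (rule set_eqI)
      fix T
      show "T \<in> forests 0 s \<longleftrightarrow> T \<in> {T \<in> {{}, {c}, {d}, {e}, {c, d}, {c, e}, {d, e}, {c, d, e}}.
          (c \<in> T \<or> d \<in> T \<and> e \<in> T, d \<in> T \<or> c \<in> T \<and> e \<in> T, e \<in> T \<or> c \<in> T \<and> d \<in> T) = s \<and>
          card T + blocks s = 3}"
        unfolding mem_Collect_eq P forests_def card
        using covers[of T] corner_state_0[of T, folded c_def d_def e_def] by metis
    qed
  qed
  have filter: "{T \<in> insert a A. P T} = (if P a then insert a {T \<in> A. P T} else {T \<in> A. P T})"
    and filter0: "{T \<in> {}. P T} = {}" for a A and P :: "vertex set set \<Rightarrow> bool" by auto
  show "forests 0 (True, True, True) = {{c, d}, {c, e}, {d, e}}"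
    "forests 0 (True, False, False) = {{c}}" "forests 0 (False, True, False) = {{d}}"
    "forests 0 (False, False, True) = {{e}}" "forests 0 (False, False, False) = {{}}"
    unfolding forests filter filter0 using n n[symmetric] by simp_all
qed

section \<open>Recursions for plain and degree-refined counts\<close>

definition forest_count :: "nat \<Rightarrow> state \<Rightarrow> nat" where
  "forest_count n s = card (forests n s)"

definition forest_deg :: "nat \<Rightarrow> nat \<Rightarrow> state \<Rightarrow> nat" where
  "forest_deg i n s = card {T \<in> forests n s. incident_edges T sg_left = i}"

lemma forest_count_0:
  "forest_count 0 (True, True, True) = 3" "forest_count 0 (True, False, False) = 1"
  "forest_count 0 (False, False, False) = 1"
proof -
  have "card {{c, d}, {c, e}, {d, e}} = 3" if "c \<noteq> d" "c \<noteq> e" "d \<noteq> e" for c d e :: "vertex set"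
    using that by (auto simp: doubleton_eq_iff)
  from this[OF forests_0(6-8)] show "forest_count 0 (True, True, True) = 3"
    by (simp add: forest_count_def forests_0)
qed (simp_all add: forest_count_def forests_0)

lemma forest_count_Suc: "forest_count (Suc n) \<pi> =
    (\<Sum>s1\<in>states. \<Sum>s2\<in>states. \<Sum>s3\<in>states. if compatible \<pi> s1 s2 s3
      then forest_count n s1 * forest_count n s2 * forest_count n s3 else 0)"
  using card_forests_Suc[of n "\<lambda>T. True" "\<lambda>T. True" \<pi>] by (simp add: forest_count_def cong: if_cong)

lemma forest_deg_Suc: "forest_deg i (Suc n) \<pi> =
    (\<Sum>s1\<in>states. \<Sum>s2\<in>states. \<Sum>s3\<in>states. if compatible \<pi> s1 s2 s3
      then forest_deg i n s1 * forest_count n s2 * forest_count n s3 else 0)"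
proof -
  have "incident_edges (merge n T1 T2 T3) sg_left = i \<longleftrightarrow> incident_edges T1 sg_left = i"
    if "T1 \<subseteq> sg_edges n" "T2 \<subseteq> sg_edges n" "T3 \<subseteq> sg_edges n" for T1 T2 T3
    using sg_merge.incident_edges_merge[of n T1 T2 T3] that by (simp add: sg_merge_def)
  from card_forests_Suc[where P = "\<lambda>T. incident_edges T sg_left = i" and
      Q = "\<lambda>T. incident_edges T sg_left = i", OF this] show ?thesis by (simp add: forest_count_def forest_deg_def cong: if_cong)
qed

text \<open>The rotational symmetry is obtained from the recursion: if the three numbers agree at
  level \<open>n\<close>, the polynomials for the three states coincide. No automorphism of the
  graph has to be constructed.\<close>

lemma forest_count_sym:
  "forest_count n (False, True, False) = forest_count n (True, False, False) \<and>
   forest_count n (False, False, True) = forest_count n (True, False, False)"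
proof (induction n)
  case 0
  show ?case by (simp add: forest_count_def forests_0)
next
  case (Suc n)
  note r = sum_compatible[of "forest_count n", OF refl refl refl refl refl
      refl refl Suc[THEN conjunct1] Suc[THEN conjunct2] refl, folded forest_count_Suc]
  show ?case unfolding r(2-4) using Suc by (simp add: algebra_simps)
qed

lemmas forest_recursion = sum_compatible[OF refl refl refl refl refl
      refl refl forest_count_sym[THEN conjunct1] forest_count_sym[THEN conjunct2] refl]

text \<open>Substituting f t = 3 g^2 gives g' = (3 + 7) f g^2 and t' = (36 + 14) g^3. The relation
  persists because both f' t' and 3 g'^2 are then 300 f^2 g^4; on the triangle it reads 3 =
  3.\<close>

lemma forest_count_three:
  "forest_count n (True, True, True) * forest_count n (False, False, False) =
     3 * forest_count n (True, False, False) ^ 2"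
  and forest_count_rec_f: "forest_count (Suc n) (True, True, True) =
     6 * forest_count n (True, True, True) ^ 2 * forest_count n (True, False, False)"
  and forest_count_rec_g: "forest_count (Suc n) (True, False, False) =
     10 * forest_count n (True, True, True) * forest_count n (True, False, False) ^ 2"
proof -
  let ?f = "\<lambda>n. forest_count n (True, True, True)" and ?g = "\<lambda>n. forest_count n (True, False, False)"
    and ?t = "\<lambda>n. forest_count n (False, False, False)"
  have f: "?f (Suc n) = 6 * ?f n ^ 2 * ?g n" for n
    unfolding forest_count_Suc forest_recursion(1)
    by (simp add: forest_count_sym power2_eq_square)
  \<comment> \<open>The product f t is kept together, here and in \<open>t\<close>, as the term that
    the invariant replaces.\<close>
  have g: "?g (Suc n) = ?f n * (?f n * ?t n) + 7 * ?f n * ?g n ^ 2" for n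
    unfolding forest_count_Suc forest_recursion(2)
    by (simp add: forest_count_sym power2_eq_square algebra_simps)
  have t: "?t (Suc n) = 12 * ?g n * (?f n * ?t n) + 14 * ?g n ^ 3" for n
    unfolding forest_count_Suc forest_recursion(5)
    by (simp add: forest_count_sym power2_eq_square power3_eq_cube algebra_simps)
  have inv: "?f n * ?t n = 3 * ?g n ^ 2" for n
  proof (induction n)
    case 0
    show ?case by (simp add: forest_count_0)
  next
    case (Suc n)
    show ?case unfolding f g t Suc by (simp add: power2_eq_square power3_eq_cube algebra_simps)
  qed
  then show "?f n * ?t n = 3 * ?g n ^ 2" .
  show "?f (Suc n) = 6 * ?f n ^ 2 * ?g n" by (rule f)
  show "?g (Suc n) = 10 * ?f n * ?g n ^ 2" unfolding g inv by simp
qed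

lemma forest_count_pos: "forest_count n (True, True, True) > 0 \<and> forest_count n (True, False, False) > 0"
proof (induction n)
  case 0
  show ?case by (simp add: forest_count_def forests_0 card_gt_0_iff)
next
  case (Suc n)
  then show ?case by (simp add: forest_count_rec_f forest_count_rec_g)
qed

text \<open>This is the reflection fixing \<open>o\<close>. In the recursion it exchanges
  \<open>ug\<close> and \<open>ur\<close>, and the sums for the two states are exchanged with
  them.\<close>

lemma forest_deg_sym: "forest_deg i n (False, True, False) = forest_deg i n (True, False, False)"
proof (induction n)
  case 0
  have "incident_edges {e} sg_left = 1" if "sg_left \<in> e" for e
  proof -
    have "{h \<in> {e}. sg_left \<in> h} = {e}" using that by blast
    then show ?thesis by (simp add: incident_edges_def)
  qed
  then have "incident_edges {{sg_left, sg_right 0}} sg_left = incident_edges {{sg_left, sg_top 0}} sg_left"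
    by simp
  then show ?case by (simp add: forest_deg_def forests_0 Collect_conv_if)
next
  case (Suc n)
  then show ?case unfolding forest_deg_Suc forest_recursion(2,3) by simp
qed

lemma forest_deg_rec_f: "forest_deg i (Suc n) (True, True, True) =
    4 * forest_count n (True, True, True) * forest_count n (True, False, False) * forest_deg i n (True, True, True) +
    2 * forest_count n (True, True, True) ^ 2 * forest_deg i n (True, False, False)"
  unfolding forest_deg_Suc forest_recursion(1)
  by (simp add: forest_deg_sym power2_eq_square algebra_simps)

text \<open>The coefficient 6 is 3 + 3, one summand being f t rewritten as 3 g^2; the 4 collects the
  states exchanged by the reflection.\<close>

lemma forest_deg_rec_g: "forest_deg i (Suc n) (True, False, False) =
    6 * forest_count n (True, False, False) ^ 2 * forest_deg i n (True, True, True) +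
    4 * forest_count n (True, True, True) * forest_count n (True, False, False) * forest_deg i n (True, False, False)"
proof -
  have "forest_deg i (Suc n) (True, False, False) =
      forest_deg i n (True, True, True) * (forest_count n (True, True, True) * forest_count n (False, False, False)) +
      3 * forest_count n (True, False, False) ^ 2 * forest_deg i n (True, True, True) +
      4 * forest_count n (True, True, True) * forest_count n (True, False, False) * forest_deg i n (True, False, False)"
    unfolding forest_deg_Suc forest_recursion(2)
    by (simp add: forest_deg_sym power2_eq_square algebra_simps)
  then show ?thesis unfolding forest_count_three by simp
qed

lemma prob_eq:
  "F_prob i n sg_left = forest_deg i n (True, True, True) / forest_count n (True, True, True)"
  "G_prob i n sg_left = forest_deg i n (True, False, False) / forest_count n (True, False, False)"
  by (simp_all add: F_prob_def G_prob_def f_deg_def g_deg_def f_count_def g_count_def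
      forest_deg_def forest_count_def sg_trees_eq_forests sg_two_trees_eq_forests)

text \<open>Divide the refined recursions by f' = 6 f^2 g and g' = 10 f g^2; all powers of f and g
  cancel and constant coefficients remain.\<close>

lemma prob_Suc:
  "F_prob i (Suc n) sg_left = 2 / 3 * F_prob i n sg_left + 1 / 3 * G_prob i n sg_left"
  "G_prob i (Suc n) sg_left = 3 / 5 * F_prob i n sg_left + 2 / 5 * G_prob i n sg_left"
  using forest_count_pos[of n]
  by (simp_all add: prob_eq forest_deg_rec_f forest_deg_rec_g forest_count_rec_f forest_count_rec_g
      field_simps power2_eq_square)

lemma prob_0:
  "F_prob 1 0 sg_left = 2 / 3" "G_prob 1 0 sg_left = 1"
  "F_prob 2 0 sg_left = 1 / 3" "G_prob 2 0 sg_left = 0"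
proof -
  define c d e where "c = {sg_left, sg_right 0}" and "d = {sg_left, sg_top 0}"
    and "e = {sg_right 0, sg_top 0}"
  note F = forests_0[folded c_def d_def e_def]
  have inc: "{h \<in> {c, d}. sg_left \<in> h} = {c, d}" "{h \<in> {c, e}. sg_left \<in> h} = {c}"
    "{h \<in> {d, e}. sg_left \<in> h} = {d}" "{h \<in> {c}. sg_left \<in> h} = {c}"
    using F(9-11) by auto
  have deg: "incident_edges {c, d} sg_left = 2" "incident_edges {c, e} sg_left = 1"
    "incident_edges {d, e} sg_left = 1" "incident_edges {c} sg_left = 1"
    unfolding incident_edges_def inc using F(6) by simp_all
  have ne: "{c, d} \<noteq> {c, e}" "{c, d} \<noteq> {d, e}" "{c, e} \<noteq> {d, e}"
    using F(6-8) by (auto simp: doubleton_eq_iff)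
  have sets: "{T \<in> {{c, d}, {c, e}, {d, e}}. incident_edges T sg_left = 1} = {{c, e}, {d, e}}"
    "{T \<in> {{c, d}, {c, e}, {d, e}}. incident_edges T sg_left = 2} = {{c, d}}"
    "{T \<in> {{c}}. incident_edges T sg_left = 1} = {{c}}"
    "{T \<in> {{c}}. incident_edges T sg_left = 2} = {}"
    using deg by auto
  show "F_prob 1 0 sg_left = 2 / 3" "G_prob 1 0 sg_left = 1"
    "F_prob 2 0 sg_left = 1 / 3" "G_prob 2 0 sg_left = 0"
    unfolding prob_eq forest_deg_def forest_count_def F sets using ne by simp_all
qed

theorem mainTheorem2:
  fixes n :: nat
  shows "F_prob 1 n sg_left = 11 / 14 - 5 / 42 * (1 / 15) ^ n \<and>
         G_prob 1 n sg_left = 11 / 14 + 3 / 14 * (1 / 15) ^ n \<and>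
         F_prob 2 n sg_left = 3 / 14 + 5 / 42 * (1 / 15) ^ n \<and>
         G_prob 2 n sg_left = 3 / 14 - 3 / 14 * (1 / 15) ^ n"
proof (induction n)
  case 0
  show ?case by (simp add: prob_0[simplified])
next
  case (Suc n)
  \<comment> \<open>The step preserves 9 F + 5 G and divides F - G by 15. The initial values of 9 F
    + 5 G are 11 for degree 1 and 3 for degree 2, whence 11/14 and 3/14. Those of F - G are -1/3 and
    1/3; they enter F with weight 5/14 and G with weight -9/14.\<close>
  then show ?case unfolding prob_Suc by (simp add: field_simps)
qed

end
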